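(* Let $C$ be a reproducing normal cone in a Banach space $(X,\|\cdot\|)$, and let $h:X\to X$ be a map that is continuous, positively homogeneous, and order-preserving with respect to $C$. Then $\tilde r(h)=r(h)$, and if $\nu(h)<r(h)$, then $r(h)=\hat r(h)$ and there exists $x\in (C\cup -C)\setminus\{0\}$ such that $h(x)=r(h)\,x$. In particular, if $r(h)\le1$ and $\nu(h)<1$, then: $h$ has a unique fixed point in $X$ (i.e. $h(x)=x$ implies $x=0$) if and only if $r(h)<1$.
   Context: A subset $C$ of the real Banach space $X$ is a cone if $tC\subset C$ for all $t\ge 0$; it is proper if it is closed, convex and pointed ($C\cap(-C)=\{0\}$). A proper cone induces the partial order $x\le y\iff y-x\in C$. $C$ is normal if it is proper and there is a constant $M$ with $\|x\|\le M\|y\|$ whenever $0\le x\le y$; it is reproducing if $X=C-C$. Positively homogeneous: $h(tx)=th(x)$ for all $t>0$. Order-preserving: $x\le y$ implies $h(x)\le h(y)$. For a homogeneous $h:X\to X$: $\|h\|=\sup_{x\ne0}\|h(x)\|/\|x\|$; Bonsall's spectral radius $\tilde r(h)=\lim_{k\to\infty}\|h^k\|^{1/k}=\inf_{k\ge1}\|h^k\|^{1/k}$; $r(h)=\sup_{x\in X}\limsup_{k\to\infty}\|h^k(x)\|^{1/k}$; $\hat r(h)=\sup\{\lambda\ge0\mid\exists x\in X\setminus\{0\},\ h(x)=\lambda x\}$ (supremum in $[0,+\infty]$). Fix a homogeneous generalized measure of noncompactness $\nu$ on $X$, that is, a map $\nu$ from the bounded subsets of $X$ to $[0,\infty)$ such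 that, for all bounded $A,B\subset X$ and scalars $\lambda$: $\nu(A)=0$ iff $\operatorname{cl}A$ is compact; $\nu(A+B)\le\nu(A)+\nu(B)$; $\nu(\operatorname{cl}\operatorname{conv}A)=\nu(A)$; $\nu(\lambda A)=|\lambda|\nu(A)$; $A\subset B$ implies $\nu(A)\le\nu(B)$. For a map $h:X\to X$, $\nu(h)=\inf\{\lambda>0\mid \nu(h(A))\le\lambda\nu(A)\text{ for all bounded }A\subset X\}$. *)

theory Defs
  imports "HOL-Analysis.Analysis"
begin

text \<open>Library \<^const>\<open>cone\<close> does not exclude the empty set; here the
  pointedness equation does.\<close>

definition proper_cone :: "'a::real_normed_vector set \<Rightarrow> bool" where
  "proper_cone C \<longleftrightarrow> cone C \<and> closed C \<and> convex C \<and> C \<inter> uminus ` C = {0}"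

definition cone_le :: "'a::real_normed_vector set \<Rightarrow> 'a \<Rightarrow> 'a \<Rightarrow> bool" where
  "cone_le C x y \<longleftrightarrow> y - x \<in> C"

definition normal_cone :: "'a::real_normed_vector set \<Rightarrow> bool" where
  "normal_cone C \<longleftrightarrow> proper_cone C \<and>
     (\<exists>M. \<forall>x y. cone_le C 0 x \<and> cone_le C x y \<longrightarrow> norm x \<le> M * norm y)"

definition reproducing_cone :: "'a::real_normed_vector set \<Rightarrow> bool" where
  "reproducing_cone C \<longleftrightarrow> {x - y | x y. x \<in> C \<and> y \<in> C} = UNIV"

definition pos_homogeneous :: "('a::real_normed_vector \<Rightarrow> 'a) \<Rightarrow> bool" where
  "pos_homogeneous h \<longleftrightarrow> (\<forall>t x. t > 0 \<longrightarrow> h (t *\<^sub>R x) = t *\<^sub>R h x)"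

definition order_preserving :: "'a::real_normed_vector set \<Rightarrow> ('a \<Rightarrow> 'a) \<Rightarrow> bool" where
  "order_preserving C h \<longleftrightarrow> (\<forall>x y. cone_le C x y \<longrightarrow> cone_le C (h x) (h y))"

text \<open>All spectral quantities take values in \<^typ>\<open>ennreal\<close>, that is \<open>[0,\<infinity>]\<close>, where the
  supremum of the empty set is \<open>0\<close> and its infimum is \<open>\<infinity>\<close>.

  \<^const>\<open>onorm\<close> is defined for arbitrary maps as the real supremum of \<open>norm (f x) / norm x\<close>
  over all \<open>x\<close>; the point \<open>x = 0\<close> contributes \<open>0\<close>.  The set is bounded for continuous
  positively homogeneous maps, so there \<^const>\<open>onorm\<close> is the norm \<open>\<parallel>h\<parallel>\<close> of \<open>h\<close>.
  The sequence in \<open>bonsall_radius\<close> is then convergent by submultiplicativity of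
  \<open>k \<mapsto> \<parallel>h\<^sup>k\<parallel>\<close>, with limit its infimum over \<open>k \<ge> 1\<close>.\<close>

definition bonsall_radius :: "('a::real_normed_vector \<Rightarrow> 'a) \<Rightarrow> ennreal" where
  "bonsall_radius h = lim (\<lambda>k. ennreal (root k (onorm (h ^^ k))))"

definition orbit_radius :: "('a::real_normed_vector \<Rightarrow> 'a) \<Rightarrow> ennreal" where
  "orbit_radius h = (SUP x. limsup (\<lambda>k. ennreal (root k (norm ((h ^^ k) x)))))"

definition eigenvalue_radius :: "('a::real_normed_vector \<Rightarrow> 'a) \<Rightarrow> ennreal" where
  "eigenvalue_radius h = Sup {ennreal l | l. 0 \<le> l \<and> (\<exists>x. x \<noteq> 0 \<and> h x = l *\<^sub>R x)}"

text \<open>Only the values of \<open>\<nu>\<close> on bounded sets are constrained.\<close>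

definition homogeneous_gmnc :: "('a::real_normed_vector set \<Rightarrow> real) \<Rightarrow> bool" where
  "homogeneous_gmnc \<nu> \<longleftrightarrow>
     (\<forall>A. bounded A \<longrightarrow> 0 \<le> \<nu> A) \<and>
     (\<forall>A. bounded A \<longrightarrow> (\<nu> A = 0 \<longleftrightarrow> compact (closure A))) \<and>
     (\<forall>A B. bounded A \<and> bounded B \<longrightarrow> \<nu> {a + b | a b. a \<in> A \<and> b \<in> B} \<le> \<nu> A + \<nu> B) \<and>
     (\<forall>A. bounded A \<longrightarrow> \<nu> (closure (convex hull A)) = \<nu> A) \<and>
     (\<forall>A c. bounded A \<longrightarrow> \<nu> ((\<lambda>x. c *\<^sub>R x) ` A) = \<bar>c\<bar> * \<nu> A) \<and>
     (\<forall>A B. bounded A \<and> bounded B \<and> A \<subseteq> B \<longrightarrow> \<nu> A \<le> \<nu> B)"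

definition map_gmnc :: "('a::real_normed_vector set \<Rightarrow> real) \<Rightarrow> ('a \<Rightarrow> 'a) \<Rightarrow> ennreal" where
  "map_gmnc \<nu> h = Inf {ennreal l | l. 0 < l \<and> (\<forall>A. bounded A \<longrightarrow> \<nu> (h ` A) \<le> l * \<nu> A)}"

end

theory Submission
  imports Defs "HOL-Real_Asymp.Real_Asymp"
begin

text \<open>Since the cone is reproducing, Baire's theorem provides decompositions \<open>x = y - z\<close> with
  \<open>y, z \<in> C\<close> of norm at most \<open>K \<parallel>x\<parallel>\<close>. Then \<open>h\<^sup>k(-z) \<le> h\<^sup>k(x) \<le> h\<^sup>k(y)\<close>, and normality reduces norm
  estimates to \<open>h\<close> and \<open>x \<mapsto> -h(-x)\<close> on the cone. There, monotonicity and Baire's theorem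
  turn pointwise bounds on orbits into uniform ones, so that the two radii agree.

  For the eigenvector normalise \<open>r(h) = 1\<close>, so that \<open>\<nu>(h) < 1\<close>, and suppose that \<open>h\<close> has no
  nonzero fixed point in the cone. For \<open>u \<in> C\<close> the equation \<open>x = u + t h(x)\<close> is solvable in \<open>C\<close> for
  \<open>t < 1\<close> by monotone iteration, and also for \<open>t = 1\<close>: normalised solutions of unbounded norm would
  accumulate at a fixed point as \<open>t \<rightarrow> 1\<close>. The solution \<open>x\<close> for \<open>t = 1\<close> satisfies \<open>h(x) \<le> x\<close>, hence
  \<open>h\<^sup>k(x)\<close> decreases to a fixed point, that is to \<open>0\<close>, and \<open>h\<^sup>k(u) \<rightarrow> 0\<close> because \<open>u \<le> x\<close>. Compactness
  makes this convergence uniform on the unit ball of \<open>C\<close>. If this holds both for \<open>h\<close> and for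
  \<open>x \<mapsto> -h(-x)\<close>, then \<open>\<parallel>h\<^sup>k\<parallel> \<rightarrow> 0\<close>, contradicting \<open>r(h) = 1\<close>.\<close>

subsection \<open>Reproducing normal cones\<close>

text \<open>A closed subset of a complete space is completely metrizable in its subspace topology,
  so countably many closed sets without interior relative to \<open>S\<close> cannot cover
  \<open>S\<close>. It is applied both to the whole space and to the cone.\<close>

lemma Baire_closed_cover:
  fixes S :: "'a::{real_normed_vector, complete_space} set" and A :: "nat \<Rightarrow> 'a set"
  assumes "closed S" "S \<noteq> {}" and clo: "\<And>n. closed (A n)" and cover: "S \<subseteq> (\<Union>n. A n)"
  obtains n x e where "x \<in> S" "0 < e" "ball x e \<inter> S \<subseteq> A n"
proof -
  let ?X = "top_of_set S" and ?G = "range (\<lambda>n. A n \<inter> S)"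
  have cm: "completely_metrizable_space ?X"
    by (simp add: assms(1) completely_metrizable_space_closedin completely_metrizable_space_euclidean)
  have "\<exists>T\<in>?G. ?X interior_of T \<noteq> {}"
  proof (rule ccontr)
    assume "\<not> ?thesis"
    then have "?X interior_of \<Union>?G = {}"
      using clo by (intro Baire_category_alt disjI1 cm) (auto simp: closedin_closed)
    moreover have "\<Union>?G = S" using cover by auto
    ultimately show False using \<open>S \<noteq> {}\<close> interior_of_topspace[of ?X] by simp
  qed
  then obtain n x where x: "x \<in> ?X interior_of (A n \<inter> S)" by blast
  then obtain T where T: "openin ?X T" "x \<in> T" "T \<subseteq> A n"
    by (auto simp: interior_of_def)
  then obtain e where "e > 0" "ball x e \<inter> S \<subseteq> T"
    by (meson openin_contains_ball)
  moreover have "x \<in> S" using T openin_subset by fastforce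
  ultimately show ?thesis using T(3) by (intro that[of x e n]) auto
qed

section \<open>Order, norm and bounded decompositions in a reproducing normal cone\<close>

locale reproducing_normal_cone =
  fixes C :: "'a::banach set"
  assumes normal: "normal_cone C" and reproducing: "reproducing_cone C"
begin

lemma closed_C: "closed C" and convex_C: "convex C" and cone_C: "cone C"
  using normal by (auto simp: normal_cone_def proper_cone_def)

lemma zero_C: "0 \<in> C"
  using normal by (auto simp: normal_cone_def proper_cone_def)

lemma scale_C: "x \<in> C \<Longrightarrow> 0 \<le> t \<Longrightarrow> t *\<^sub>R x \<in> C"
  using cone_C by (auto simp: cone_def)

lemma add_C: "x \<in> C \<Longrightarrow> y \<in> C \<Longrightarrow> x + y \<in> C"
  using convex_C cone_C convex_cone[of C] by simp

lemma diff_trans_C: "y - x \<in> C \<Longrightarrow> z - y \<in> C \<Longrightarrow> z - x \<in> C"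
  using add_C[of "y - x" "z - y"] by simp

lemma sum_C: "(\<And>i. i \<in> I \<Longrightarrow> f i \<in> C) \<Longrightarrow> sum f I \<in> C"
  by (induction I rule: infinite_finite_induct) (auto simp: zero_C intro!: add_C)

lemma suminf_C:
  fixes f :: "nat \<Rightarrow> 'a"
  assumes "summable f" "\<And>i. f i \<in> C"
  shows "suminf f \<in> C"
  by (rule closed_sequentially[OF closed_C _ summable_LIMSEQ[OF assms(1)]]) (intro sum_C assms)

lemma term_le_suminf:
  fixes f :: "nat \<Rightarrow> 'a"
  assumes "summable f" "\<And>i. f i \<in> C"
  shows "suminf f - f i \<in> C"
proof -
  have "suminf f = (\<Sum>n. f (n + Suc i)) + sum f {..<Suc i}"
    by (rule suminf_split_initial_segment[OF assms(1)])
  then have "suminf f - f i = (\<Sum>n. f (n + Suc i)) + sum f {..<i}" by simp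
  then show ?thesis
    by (simp only:) (intro add_C sum_C suminf_C summable_ignore_initial_segment assms)
qed

lemma normality:
  obtains M where "M > 0" "\<And>x y. x \<in> C \<Longrightarrow> y - x \<in> C \<Longrightarrow> norm x \<le> M * norm y"
proof -
  obtain M where M: "\<And>x y. x \<in> C \<Longrightarrow> y - x \<in> C \<Longrightarrow> norm x \<le> M * norm y"
    using normal by (auto simp: normal_cone_def cone_le_def)
  \<comment> \<open>Normality provides a constant of unspecified sign; the maximum with
    \<open>1\<close> makes it positive.\<close>
  have "norm x \<le> max M 1 * norm y" if "x \<in> C" "y - x \<in> C" for x y
    using M[OF that] mult_right_mono[of M "max M 1" "norm y"] by simp
  then show ?thesis by (intro that[of "max M 1"]) auto
qed

text \<open>From \<open>a \<le> x \<le> b\<close> follows \<open>0 \<le> x - a \<le> b - a\<close>,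
  so normality applies to \<open>x - a\<close>, and the triangle inequality adds
  \<open>norm a\<close> back.\<close>

lemma sandwich:
  obtains M where "M > 0"
    "\<And>a b x. x - a \<in> C \<Longrightarrow> b - x \<in> C \<Longrightarrow> norm x \<le> M * (norm a + norm b)"
proof -
  obtain M where M: "M > 0" "\<And>x y. x \<in> C \<Longrightarrow> y - x \<in> C \<Longrightarrow> norm x \<le> M * norm y"
    by (rule normality) blast
  have "norm x \<le> (1 + M) * (norm a + norm b)" if "x - a \<in> C" "b - x \<in> C" for a b x
  proof -
    have "norm x \<le> norm a + norm (x - a)" by (metis norm_triangle_sub)
    also have "norm (x - a) \<le> M * norm (b - a)"
      using that by (intro M) auto
    also have "norm (b - a) \<le> norm a + norm b"
      using norm_triangle_ineq4[of b a] by simp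
    finally have "norm x \<le> norm a + M * (norm a + norm b)" using M(1) by simp
    moreover have "norm a + M * (norm a + norm b) \<le> (1 + M) * (norm a + norm b)"
      by (simp add: algebra_simps)
    ultimately show ?thesis by linarith
  qed
  with M(1) show ?thesis by (intro that[of "1 + M"]) auto
qed

text \<open>This is the Baire half of the open mapping theorem for the map
  \<open>(y, z) \<mapsto> y - z\<close> on pairs of cone elements: the closure of some
  \<open>B n\<close> contains a ball, which is moved to the origin and then rescaled.\<close>

lemma approx_decomposition:
  obtains K where "K > 0"
    "\<And>v. \<exists>y\<in>C. \<exists>z\<in>C. norm y \<le> K * norm v \<and> norm z \<le> K * norm v \<and> norm (v - (y - z)) \<le> norm v / 2"
proof -
  define B where "B n = {y - z | y z. y \<in> C \<and> z \<in> C \<and> norm y \<le> real n \<and> norm z \<le> real n}" for n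
  have "UNIV \<subseteq> (\<Union>n. closure (B n))"
  proof
    fix x :: 'a
    have "x \<in> {y - z | y z. y \<in> C \<and> z \<in> C}"
      using reproducing by (simp add: reproducing_cone_def)
    then obtain y z where "y \<in> C" "z \<in> C" "x = y - z" by blast
    moreover obtain n where "max (norm y) (norm z) \<le> real n" using real_arch_simple by blast
    ultimately have "x \<in> B n" by (auto simp: B_def)
    then show "x \<in> (\<Union>n. closure (B n))" using closure_subset by blast
  qed
  then obtain n x0 e where e: "e > 0" and ball: "ball x0 e \<subseteq> closure (B n)"
    using Baire_closed_cover[of UNIV "\<lambda>n. closure (B n)"]
    by (metis UNIV_not_empty closed_UNIV closed_closure inf_top.right_neutral)
  \<comment> \<open>Both \<open>x0 + u\<close> and \<open>x0\<close> are approximated from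
    \<open>B n\<close>. The difference of the approximations is regrouped as
    \<open>(y + z') - (z + y')\<close>, which doubles the bound \<open>n\<close>.\<close>
  have close: "\<exists>y\<in>C. \<exists>z\<in>C. norm y \<le> 2 * n \<and> norm z \<le> 2 * n \<and> norm (u - (y - z)) < d"
    if u: "norm u < e" and d: "d > 0" for u d
  proof -
    have "x0 + u \<in> closure (B n)" "x0 \<in> closure (B n)"
      using ball u e by (auto simp: subset_iff dist_norm)
    then obtain p q where p: "p \<in> B n" "dist p (x0 + u) < d/2" and q: "q \<in> B n" "dist q x0 < d/2"
      using d half_gt_zero unfolding closure_approachable by metis
    obtain y z where yz: "p = y - z" "y \<in> C" "z \<in> C" "norm y \<le> n" "norm z \<le> n"
      using p(1) by (auto simp: B_def)
    obtain y' z' where yz': "q = y' - z'" "y' \<in> C" "z' \<in> C" "norm y' \<le> n" "norm z' \<le> n"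
      using q(1) by (auto simp: B_def)
    have "norm (u - ((y + z') - (z + y'))) = norm ((q - x0) - (p - (x0 + u)))"
      by (simp add: yz yz' algebra_simps)
    also have "\<dots> < d"
      using norm_triangle_ineq4[of "q - x0" "p - (x0 + u)"] p(2) q(2) by (simp add: dist_norm)
    finally have "norm (u - ((y + z') - (z + y'))) < d" .
    moreover have "norm (y + z') \<le> 2 * n" "norm (z + y') \<le> 2 * n"
      using norm_triangle_ineq[of y z'] norm_triangle_ineq[of z y'] yz yz' by auto
    ultimately show ?thesis using yz yz' by (meson add_C)
  qed
  \<comment> \<open>With \<open>s = e / (2 * norm v)\<close> below, the bound \<open>2 * n\<close>
    divided by \<open>s\<close> is \<open>4 * n * norm v / e\<close>; the summand \<open>1\<close>
    keeps \<open>K\<close> positive for \<open>n = 0\<close>.\<close>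
  define K where "K = (4 * real n + 1) / e"
  show ?thesis
  proof (rule that[of K])
    show "K > 0" using e by (simp add: K_def)
    fix v :: 'a
    show "\<exists>y\<in>C. \<exists>z\<in>C. norm y \<le> K * norm v \<and> norm z \<le> K * norm v \<and> norm (v - (y - z)) \<le> norm v / 2"
    proof (cases "v = 0")
      case True
      then show ?thesis using zero_C by (intro bexI[of _ 0]) auto
    next
      case False
      define s where "s = e / (2 * norm v)"
      have s: "s > 0" using e False by (simp add: s_def)
      have "norm (s *\<^sub>R v) < e" using e False by (simp add: s_def)
      then obtain y z where yz: "y \<in> C" "z \<in> C" "norm y \<le> 2 * n" "norm z \<le> 2 * n"
        "norm (s *\<^sub>R v - (y - z)) < s * norm v / 2"
        using close[of "s *\<^sub>R v" "s * norm v / 2"] s False by auto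
      have K: "2 * real n \<le> s * (K * norm v)"
        using e False by (simp add: s_def K_def field_simps)
      have "s *\<^sub>R (v - ((1/s) *\<^sub>R y - (1/s) *\<^sub>R z)) = s *\<^sub>R v - (y - z)"
        using s by (simp add: scaleR_right_diff_distrib)
      then have "s * norm (v - ((1/s) *\<^sub>R y - (1/s) *\<^sub>R z)) < s * (norm v / 2)"
        using yz(5) s by (metis abs_of_pos norm_scaleR times_divide_eq_right)
      then have "norm (v - ((1/s) *\<^sub>R y - (1/s) *\<^sub>R z)) \<le> norm v / 2"
        using s by simp
      moreover have "norm ((1/s) *\<^sub>R y) \<le> K * norm v" "norm ((1/s) *\<^sub>R z) \<le> K * norm v"
        using K yz(3,4) s by (simp_all add: field_simps)
      ultimately show ?thesis using yz(1,2) s by (meson less_imp_le scale_C zero_less_divide_1_iff)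
    qed
  qed
qed

text \<open>This is the completeness half of the open mapping argument: the approximate
  decomposition is applied again to its own error. The errors halve, so the cone parts form two
  convergent series, which costs a factor \<open>2\<close> in the constant.\<close>

lemma decomposition:
  obtains K where "K > 0"
    "\<And>v. \<exists>y\<in>C. \<exists>z\<in>C. norm y \<le> K * norm v \<and> norm z \<le> K * norm v \<and> v = y - z"
proof -
  obtain K where K: "K > 0" and
    "\<And>v. \<exists>y\<in>C. \<exists>z\<in>C. norm y \<le> K * norm v \<and> norm z \<le> K * norm v \<and> norm (v - (y - z)) \<le> norm v / 2"
    by (rule approx_decomposition) blast
  then obtain Y Z where YZ: "\<And>v. Y v \<in> C" "\<And>v. Z v \<in> C" "\<And>v. norm (Y v) \<le> K * norm v"
    "\<And>v. norm (Z v) \<le> K * norm v" "\<And>v. norm (v - (Y v - Z v)) \<le> norm v / 2"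
    by metis
  have "\<exists>y\<in>C. \<exists>z\<in>C. norm y \<le> 2 * K * norm v \<and> norm z \<le> 2 * K * norm v \<and> v = y - z" for v
  proof -
    \<comment> \<open>\<open>w i\<close> is the error left after \<open>i\<close> rounds; summing
      the differences of successive errors telescopes to \<open>v\<close>.\<close>
    define w where "w i = ((\<lambda>v. v - (Y v - Z v)) ^^ i) v" for i
    have w0: "w 0 = v" and wS: "w (Suc i) = w i - (Y (w i) - Z (w i))" for i
      by (simp_all add: w_def)
    have w: "norm (w i) \<le> norm v * (1/2) ^ i" for i
    proof (induction i)
      case (Suc i)
      then show ?case using YZ(5)[of "w i"] by (simp add: wS)
    qed (simp add: w0)
    have geo: "(\<lambda>i. K * (norm v * (1/2) ^ i)) sums (2 * K * norm v)"
      using sums_mult[OF geometric_sums[of "1/2::real"], of "K * norm v"] by (simp add: mult_ac)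
    have part: "summable (\<lambda>i. F (w i)) \<and> suminf (\<lambda>i. F (w i)) \<in> C \<and>
        norm (suminf (\<lambda>i. F (w i))) \<le> 2 * K * norm v"
      if F: "\<And>v. F v \<in> C" "\<And>v. norm (F v) \<le> K * norm v" for F
    proof -
      have le: "norm (F (w i)) \<le> K * (norm v * (1/2) ^ i)" for i
        using order_trans[OF F(2)[of "w i"] mult_left_mono[OF w[of i], of K]] K by simp
      have sn: "summable (\<lambda>i. norm (F (w i)))"
        by (rule summable_comparison_test[OF _ sums_summable[OF geo]]) (use le in auto)
      have "norm (suminf (\<lambda>i. F (w i))) \<le> (\<Sum>i. norm (F (w i)))"
        by (rule summable_norm[OF sn])
      also have "\<dots> \<le> 2 * K * norm v"
        using suminf_le[OF le sn sums_summable[OF geo]] sums_unique[OF geo] by simp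
      finally show ?thesis
        using summable_norm_cancel[OF sn] F(1) by (auto intro!: suminf_C)
    qed
    have "(\<lambda>i. norm v * (1/2::real) ^ i) \<longlonglongrightarrow> norm v * 0"
      by (intro tendsto_mult tendsto_const LIMSEQ_realpow_zero) auto
    then have "(\<lambda>i. norm v * (1/2::real) ^ i) \<longlonglongrightarrow> 0" by simp
    then have "w \<longlonglongrightarrow> 0"
      using w by (rule Lim_null_comparison[rotated, OF _ always_eventually[OF allI]])
    from telescope_sums'[OF this] have "(\<lambda>i. Y (w i) - Z (w i)) sums v"
      by (simp add: wS w0)
    moreover have "(\<lambda>i. Y (w i) - Z (w i)) sums (suminf (\<lambda>i. Y (w i)) - suminf (\<lambda>i. Z (w i)))"
      using part[of Y] part[of Z] YZ by (intro sums_diff summable_sums) auto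
    ultimately have "v = suminf (\<lambda>i. Y (w i)) - suminf (\<lambda>i. Z (w i))"
      by (rule sums_unique2)
    then show ?thesis using part[of Y] part[of Z] YZ by blast
  qed
  with K show ?thesis by (intro that[of "2 * K"]) auto
qed

end

text \<open>If \<open>v = y - z\<close> then \<open>- z \<le> v \<le> y\<close>, and monotone maps
  keep this sandwich. As \<open>y\<close> and \<open>z\<close> are chosen before \<open>f\<close>, a
  single decomposition serves all iterates of a map.\<close>

lemma (in reproducing_normal_cone) split_bound:
  obtains K where "K > 0"
    "\<And>v. \<exists>y\<in>C. \<exists>z\<in>C. norm y \<le> K * norm v \<and> norm z \<le> K * norm v \<and>
       (\<forall>f. order_preserving C f \<longrightarrow> norm (f v) \<le> K * (norm (f y) + norm (f (- z))))"
proof -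
  obtain M where M: "M > 0"
    "\<And>a b x. x - a \<in> C \<Longrightarrow> b - x \<in> C \<Longrightarrow> norm x \<le> M * (norm a + norm b)"
    by (rule sandwich) blast
  obtain K where K: "K > 0"
    "\<And>v. \<exists>y\<in>C. \<exists>z\<in>C. norm y \<le> K * norm v \<and> norm z \<le> K * norm v \<and> v = y - z"
    by (rule decomposition) blast
  show ?thesis
  proof (rule that[of "max M K"])
    fix v
    obtain y z where yz: "y \<in> C" "z \<in> C" "norm y \<le> K * norm v" "norm z \<le> K * norm v" "v = y - z"
      using K(2)[of v] by blast
    have "norm (f v) \<le> max M K * (norm (f y) + norm (f (- z)))" if "order_preserving C f" for f
    proof -
      have "f v - f (- z) \<in> C" "f y - f v \<in> C"
        using that yz unfolding order_preserving_def cone_le_def by simp_all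
      from M(2)[OF this] have "norm (f v) \<le> M * (norm (f y) + norm (f (- z)))"
        by (simp add: add.commute)
      also have "\<dots> \<le> max M K * (norm (f y) + norm (f (- z)))"
        by (intro mult_right_mono) auto
      finally show ?thesis .
    qed
    moreover have "K * norm v \<le> max M K * norm v"
      by (intro mult_right_mono) auto
    ultimately show "\<exists>y\<in>C. \<exists>z\<in>C. norm y \<le> max M K * norm v \<and> norm z \<le> max M K * norm v \<and>
       (\<forall>f. order_preserving C f \<longrightarrow> norm (f v) \<le> max M K * (norm (f y) + norm (f (- z))))"
      using yz by (meson order_trans)
  qed (use M in auto)
qed

subsection \<open>Order-preserving homogeneous maps\<close>

locale cone_map = reproducing_normal_cone C for C :: "'a::banach set" +
  fixes h :: "'a \<Rightarrow> 'a"
  assumes cont: "continuous_on UNIV h"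
    and homogeneous: "pos_homogeneous h"
    and order: "order_preserving C h"
begin

lemma map_zero: "h 0 = 0"
proof -
  have "h (2 *\<^sub>R 0) = 2 *\<^sub>R h 0"
    using homogeneous unfolding pos_homogeneous_def by (meson zero_less_numeral)
  then have "h 0 = 2 *\<^sub>R h 0" by simp
  then show ?thesis by (simp add: scaleR_2)
qed

lemma map_scale: "0 \<le> t \<Longrightarrow> h (t *\<^sub>R x) = t *\<^sub>R h x"
  using homogeneous map_zero by (cases "t = 0") (auto simp: pos_homogeneous_def)

lemma map_mono: "y - x \<in> C \<Longrightarrow> h y - h x \<in> C"
  using order by (simp add: order_preserving_def cone_le_def)

lemma map_C: "x \<in> C \<Longrightarrow> h x \<in> C"
  using map_mono[of x 0] by (simp add: map_zero)

text \<open>Continuity at \<open>0\<close> bounds \<open>h\<close> by \<open>1\<close> on a small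
  ball, and homogeneity spreads the bound to all vectors; additivity does not enter.\<close>

lemma norm_bound:
  obtains L where "L > 0" "\<And>x. norm (h x) \<le> L * norm x"
proof -
  have "isCont h 0" using cont by (simp add: continuous_on_eq_continuous_at)
  then obtain d where d: "d > 0" "\<And>x. norm x < d \<Longrightarrow> norm (h x) < 1"
    unfolding continuous_at_eps_delta dist_norm map_zero
    by (metis diff_zero zero_less_one)
  have "norm (h x) \<le> 2 / d * norm x" for x
  proof (cases "x = 0")
    case False
    define s where "s = d / (2 * norm x)"
    have s: "s > 0" "norm (s *\<^sub>R x) < d" using d(1) False by (auto simp: s_def)
    then have "s * norm (h x) < 1"
      using d(2)[OF s(2)] by (simp add: map_scale)
    then have "norm (h x) \<le> 1 / s" using s(1) by (simp add: field_simps)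
    then show ?thesis by (simp add: s_def)
  qed (simp add: map_zero)
  with d(1) show ?thesis by (intro that[of "2 / d"]) auto
qed

lemma bounded_image: "bounded A \<Longrightarrow> bounded (h ` A)"
proof -
  assume "bounded A"
  then obtain b where b: "\<And>x. x \<in> A \<Longrightarrow> norm x \<le> b" unfolding bounded_iff by blast
  obtain L where "L > 0" "\<And>x. norm (h x) \<le> L * norm x" by (rule norm_bound) blast
  then have "\<And>x. x \<in> A \<Longrightarrow> norm (h x) \<le> L * b"
    by (meson b mult_left_mono less_imp_le order_trans)
  then show "bounded (h ` A)" unfolding bounded_iff by blast
qed

lemma isCont_map: "isCont h x"
  using cont by (simp add: continuous_on_eq_continuous_at)

section \<open>Iterates, multiples and reflections\<close>

lemma cone_map_funpow: "cone_map C (h ^^ k)"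
proof (induction k)
  case 0
  show ?case
    by unfold_locales (auto simp: pos_homogeneous_def order_preserving_def id_def)
next
  case (Suc k)
  interpret k: cone_map C "h ^^ k" by fact
  show ?case
  proof
    show "continuous_on UNIV (h ^^ Suc k)"
      unfolding funpow.simps by (rule continuous_on_compose[OF k.cont continuous_on_subset[OF cont]]) simp
    show "pos_homogeneous (h ^^ Suc k)"
      by (simp add: pos_homogeneous_def map_scale k.map_scale)
    show "order_preserving C (h ^^ Suc k)"
      by (simp add: order_preserving_def cone_le_def map_mono k.map_mono)
  qed
qed

lemmas funpow_C = cone_map.map_C[OF cone_map_funpow]
  and funpow_mono = cone_map.map_mono[OF cone_map_funpow]
  and funpow_scale = cone_map.map_scale[OF cone_map_funpow]
  and funpow_zero = cone_map.map_zero[OF cone_map_funpow]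
  and funpow_cont = cone_map.cont[OF cone_map_funpow]
  and funpow_order = cone_map.order[OF cone_map_funpow]

lemma cone_map_scaleR: "0 \<le> c \<Longrightarrow> cone_map C (\<lambda>x. c *\<^sub>R h x)"
proof unfold_locales
  assume c: "0 \<le> c"
  show "continuous_on UNIV (\<lambda>x. c *\<^sub>R h x)" by (intro continuous_intros cont)
  show "pos_homogeneous (\<lambda>x. c *\<^sub>R h x)" by (simp add: pos_homogeneous_def map_scale)
  show "order_preserving C (\<lambda>x. c *\<^sub>R h x)"
    using scale_C[OF map_mono c]
    by (simp add: order_preserving_def cone_le_def scaleR_right_diff_distrib)
qed

text \<open>Conjugation with \<open>x \<mapsto> - x\<close> reverses the order twice. The behaviour
  of \<open>h\<close> on the negative cone thus becomes that of the reflected map on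
  \<open>C\<close>.\<close>

lemma cone_map_reflect: "cone_map C (\<lambda>x. - h (- x))"
proof unfold_locales
  show "continuous_on UNIV (\<lambda>x. - h (- x))"
    by (intro continuous_intros continuous_on_compose2[OF cont]) auto
  show "pos_homogeneous (\<lambda>x. - h (- x))"
    using homogeneous by (simp add: pos_homogeneous_def flip: scaleR_minus_right)
  show "order_preserving C (\<lambda>x. - h (- x))"
    using map_mono[of "- x" "- y" for x y] by (simp add: order_preserving_def cone_le_def)
qed

lemma funpow_scaleR: "0 \<le> c \<Longrightarrow> ((\<lambda>x. c *\<^sub>R h x) ^^ k) x = c ^ k *\<^sub>R (h ^^ k) x"
  by (induction k) (auto simp: map_scale)

lemma funpow_reflect: "((\<lambda>x. - h (- x)) ^^ k) x = - (h ^^ k) (- x)"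
  by (induction k) auto

text \<open>A uniform boundedness principle without linearity. Baire's theorem in \<open>C\<close>
  gives a relative ball around \<open>x0\<close> with uniformly bounded orbits. Where a linear map
  would allow subtraction of \<open>x0\<close>, the inequality \<open>s u \<le> x0 + s u\<close>
  with monotonicity and normality bounds the orbit of \<open>s u\<close>.\<close>

lemma uniformly_bounded_orbits_C:
  assumes "\<And>u. u \<in> C \<Longrightarrow> \<exists>M. \<forall>k. norm ((h ^^ k) u) \<le> M"
  obtains K where "K > 0" "\<And>u k. u \<in> C \<Longrightarrow> norm ((h ^^ k) u) \<le> K * norm u"
proof -
  define A where "A n = {u. \<forall>k. norm ((h ^^ k) u) \<le> real n}" for n
  have "closed (A n)" for n
    unfolding A_def by (intro closed_Collect_all closed_Collect_le continuous_intros funpow_cont)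
  moreover have "C \<subseteq> (\<Union>n. A n)"
  proof
    fix u assume "u \<in> C"
    then obtain M where M: "\<And>k. norm ((h ^^ k) u) \<le> M" using assms by blast
    obtain n where "M \<le> real n" using real_arch_simple by blast
    then have "u \<in> A n" using M order_trans unfolding A_def by blast
    then show "u \<in> (\<Union>n. A n)" by blast
  qed
  ultimately obtain n x0 e where x0: "x0 \<in> C" "e > 0" "ball x0 e \<inter> C \<subseteq> A n"
    using Baire_closed_cover[of C A] closed_C zero_C by (metis empty_iff)
  obtain M where M: "M > 0" "\<And>x y. x \<in> C \<Longrightarrow> y - x \<in> C \<Longrightarrow> norm x \<le> M * norm y"
    by (rule normality) blast
  define K where "K = 2 * M * real n / e + 1"
  have "norm ((h ^^ k) u) \<le> K * norm u" if u: "u \<in> C" for u k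
  proof (cases "u = 0")
    case False
    define s where "s = e / (2 * norm u)"
    have s: "s > 0" "norm (s *\<^sub>R u) < e" using x0(2) False by (auto simp: s_def)
    have su: "s *\<^sub>R u \<in> C" using u s by (simp add: scale_C)
    have "x0 + s *\<^sub>R u \<in> ball x0 e \<inter> C" using s su x0 by (auto simp: dist_norm add_C)
    then have n: "norm ((h ^^ k) (x0 + s *\<^sub>R u)) \<le> n" using x0(3) by (auto simp: A_def)
    have "s * norm ((h ^^ k) u) = norm ((h ^^ k) (s *\<^sub>R u))"
      using s by (simp add: funpow_scale)
    also have "\<dots> \<le> M * norm ((h ^^ k) (x0 + s *\<^sub>R u))"
      by (intro M funpow_C funpow_mono su) (simp add: x0)
    also have "\<dots> \<le> M * n" using n M(1) by simp
    finally have "norm ((h ^^ k) u) \<le> M * n / s" using s(1) by (simp add: field_simps)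
    also have "\<dots> \<le> K * norm u"
      by (simp add: s_def K_def algebra_simps)
    finally show ?thesis .
  qed (simp add: funpow_zero)
  moreover have "K > 0" using M(1) x0(2) by (simp add: K_def add_nonneg_pos)
  ultimately show ?thesis using that by blast
qed

text \<open>The bound on the cone is used for \<open>h\<close> and for its reflection, and
  \<open>split_bound\<close> combines the two.\<close>

lemma uniformly_bounded_orbits:
  assumes "\<And>x. \<exists>M. \<forall>k. norm ((h ^^ k) x) \<le> M"
  obtains K where "K > 0" "\<And>x k. norm ((h ^^ k) x) \<le> K * norm x"
proof -
  interpret g: cone_map C "\<lambda>x. - h (- x)" by (rule cone_map_reflect)
  obtain K where K: "K > 0" "\<And>u k. u \<in> C \<Longrightarrow> norm ((h ^^ k) u) \<le> K * norm u"
    by (rule uniformly_bounded_orbits_C) (use assms in blast)+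
  obtain K' where K': "K' > 0" "\<And>u k. u \<in> C \<Longrightarrow> norm ((h ^^ k) (- u)) \<le> K' * norm u"
    by (rule g.uniformly_bounded_orbits_C) (use assms in \<open>auto simp: funpow_reflect\<close>)
  obtain N where N: "N > 0"
    "\<And>v. \<exists>y\<in>C. \<exists>z\<in>C. norm y \<le> N * norm v \<and> norm z \<le> N * norm v \<and>
       (\<forall>f. order_preserving C f \<longrightarrow> norm (f v) \<le> N * (norm (f y) + norm (f (- z))))"
    by (rule split_bound) blast
  have "norm ((h ^^ k) x) \<le> (N * (K * N + K' * N)) * norm x" for x k
  proof -
    obtain y z where yz: "y \<in> C" "z \<in> C" "norm y \<le> N * norm x" "norm z \<le> N * norm x"
      "norm ((h ^^ k) x) \<le> N * (norm ((h ^^ k) y) + norm ((h ^^ k) (- z)))"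
      using N(2)[of x] funpow_order by blast
    have "norm ((h ^^ k) y) \<le> K * (N * norm x)" "norm ((h ^^ k) (- z)) \<le> K' * (N * norm x)"
      using K(2)[OF yz(1), of k] K'(2)[OF yz(2), of k]
        mult_left_mono[OF yz(3), of K] mult_left_mono[OF yz(4), of K'] K(1) K'(1) by linarith+
    then have "norm ((h ^^ k) x) \<le> N * (K * (N * norm x) + K' * (N * norm x))"
      using yz(5) N(1) by (smt (verit) mult_left_mono)
    then show ?thesis by (simp add: algebra_simps)
  qed
  moreover have "N * (K * N + K' * N) > 0" using K(1) K'(1) N(1) by (simp add: add_pos_pos)
  ultimately show ?thesis using that by blast
qed

lemma uniform_growth_rate:
  assumes q: "q > 0" and "\<And>x. \<exists>M. \<forall>k. norm ((h ^^ k) x) \<le> M * q ^ k"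
  obtains K where "K > 0" "\<And>x k. norm ((h ^^ k) x) \<le> K * q ^ k * norm x"
proof -
  interpret s: cone_map C "\<lambda>x. (1/q) *\<^sub>R h x" by (rule cone_map_scaleR) (use q in simp)
  have eq: "norm (((\<lambda>x. (1/q) *\<^sub>R h x) ^^ k) x) = norm ((h ^^ k) x) / q ^ k" for k x
    using q funpow_scaleR[of "1/q" k x] by (simp add: power_divide)
  have "\<exists>M. \<forall>k. norm (((\<lambda>x. (1/q) *\<^sub>R h x) ^^ k) x) \<le> M" for x
    using assms(2)[of x] q by (simp add: eq divide_le_eq)
  from s.uniformly_bounded_orbits[OF this]
  obtain K where "K > 0" "\<And>x k. norm ((h ^^ k) x) / q ^ k \<le> K * norm x"
    unfolding eq by blast
  with q show ?thesis by (intro that[of K]) (auto simp: divide_le_eq mult_ac)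
qed

text \<open>Write \<open>k = k mod m + m * (k div m)\<close>: every full block of \<open>m\<close>
  steps contributes \<open>q ^ m\<close>, and the fewer than \<open>m\<close> remaining steps
  contribute a bounded factor.\<close>

lemma growth_rate_of_iterate:
  assumes m: "m \<ge> 1" and q: "q > 0" and le: "\<And>x. norm ((h ^^ m) x) \<le> q ^ m * norm x"
  obtains M where "M > 0" "\<And>x k. norm ((h ^^ k) x) \<le> M * q ^ k * norm x"
proof -
  obtain L where L: "L > 0" "\<And>x. norm (h x) \<le> L * norm x" by (rule norm_bound) blast
  \<comment> \<open>\<open>P\<close> measures how far one step may exceed the rate \<open>q\<close>;
    \<open>P \<ge> 1\<close> permits replacing the exponent \<open>k mod m\<close> by
    \<open>m\<close>.\<close>
  define P where "P = max 1 (L / q)"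
  have P: "P \<ge> 1" "L \<le> P * q" using q by (auto simp: P_def field_simps max_def)
  have small: "norm ((h ^^ i) x) \<le> (P * q) ^ i * norm x" for i x
  proof (induction i)
    case (Suc i)
    have "norm ((h ^^ Suc i) x) \<le> L * norm ((h ^^ i) x)" by (simp add: L)
    also have "\<dots> \<le> (P * q) * ((P * q) ^ i * norm x)"
      using Suc P L(1) q by (intro mult_mono) auto
    finally show ?case by (simp add: mult_ac)
  qed simp
  have big: "norm ((h ^^ (m * j)) x) \<le> q ^ (m * j) * norm x" for j x
  proof (induction j)
    case (Suc j)
    have "(h ^^ (m * Suc j)) x = (h ^^ m) ((h ^^ (m * j)) x)" by (simp add: funpow_add)
    then have "norm ((h ^^ (m * Suc j)) x) \<le> q ^ m * norm ((h ^^ (m * j)) x)" by (simp add: le)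
    also have "\<dots> \<le> q ^ m * (q ^ (m * j) * norm x)"
      using Suc q by (intro mult_left_mono) auto
    finally show ?case by (simp add: power_add mult_ac)
  qed simp
  have "norm ((h ^^ k) x) \<le> P ^ m * q ^ k * norm x" for k x
  proof -
    have k: "k = k mod m + m * (k div m)" by simp
    have "(h ^^ k) x = (h ^^ (k mod m)) ((h ^^ (m * (k div m))) x)"
      by (subst k, subst funpow_add) simp
    then have "norm ((h ^^ k) x) \<le> (P * q) ^ (k mod m) * norm ((h ^^ (m * (k div m))) x)"
      by (simp add: small)
    also have "\<dots> \<le> (P * q) ^ (k mod m) * (q ^ (m * (k div m)) * norm x)"
      using big q P by (intro mult_left_mono) auto
    also have "\<dots> = P ^ (k mod m) * (q ^ (k mod m) * q ^ (m * (k div m))) * norm x"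
      by (simp add: power_mult_distrib mult_ac)
    also have "q ^ (k mod m) * q ^ (m * (k div m)) = q ^ k"
      using k by (metis power_add)
    also have "P ^ (k mod m) * q ^ k * norm x \<le> P ^ m * q ^ k * norm x"
      using P q m by (intro mult_right_mono power_increasing) (auto intro: less_imp_le)
    finally show ?thesis .
  qed
  then show ?thesis using P by (intro that[of "P ^ m"]) auto
qed

end

subsection \<open>Measures of noncompactness\<close>

lemma bounded_sumset:
  fixes A B :: "'a::real_normed_vector set"
  assumes "bounded A" "bounded B"
  shows "bounded {a + b | a b. a \<in> A \<and> b \<in> B}"
  by (rule bounded_subset[OF bounded_sums[OF assms]]) auto

lemma bounded_shrink:
  fixes B :: "'a::real_normed_vector set"
  assumes "bounded B"
  shows "bounded {s *\<^sub>R b | s b. 0 \<le> s \<and> s \<le> 1 \<and> b \<in> B}"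
proof -
  obtain c where c: "\<And>x. x \<in> B \<Longrightarrow> norm x \<le> c" using assms unfolding bounded_iff by blast
  have "norm (s *\<^sub>R b) \<le> c" if "0 \<le> s" "s \<le> 1" "b \<in> B" for s b
    using mult_left_le_one_le[of "norm b" s] c[OF that(3)] that by auto
  then show ?thesis unfolding bounded_iff by blast
qed

locale gmnc =
  fixes \<nu> :: "'a::real_normed_vector set \<Rightarrow> real"
  assumes gmnc: "homogeneous_gmnc \<nu>"
begin

lemma gmnc_nonneg: "bounded A \<Longrightarrow> 0 \<le> \<nu> A"
  and gmnc_eq_0_iff: "bounded A \<Longrightarrow> \<nu> A = 0 \<longleftrightarrow> compact (closure A)"
  and gmnc_sum: "bounded A \<Longrightarrow> bounded B \<Longrightarrow> \<nu> {a + b | a b. a \<in> A \<and> b \<in> B} \<le> \<nu> A + \<nu> B"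
  and gmnc_hull: "bounded A \<Longrightarrow> \<nu> (closure (convex hull A)) = \<nu> A"
  and gmnc_scale: "bounded A \<Longrightarrow> \<nu> ((\<lambda>x. c *\<^sub>R x) ` A) = \<bar>c\<bar> * \<nu> A"
  using gmnc by (simp_all add: homogeneous_gmnc_def)

lemma gmnc_mono: "bounded B \<Longrightarrow> A \<subseteq> B \<Longrightarrow> \<nu> A \<le> \<nu> B"
  using gmnc bounded_subset[of B A] by (simp add: homogeneous_gmnc_def)

lemma gmnc_compact: "compact K \<Longrightarrow> \<nu> K = 0"
  by (simp add: gmnc_eq_0_iff compact_imp_bounded compact_imp_closed)

lemma gmnc_compact_plus:
  assumes "compact K" "bounded B" "A \<subseteq> {k + b | k b. k \<in> K \<and> b \<in> B}"
  shows "\<nu> A \<le> \<nu> B"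
proof -
  have K: "bounded K" using assms(1) by (rule compact_imp_bounded)
  have "\<nu> A \<le> \<nu> {k + b | k b. k \<in> K \<and> b \<in> B}"
    by (rule gmnc_mono[OF bounded_sumset[OF K assms(2)] assms(3)])
  also have "\<dots> \<le> \<nu> K + \<nu> B" by (rule gmnc_sum[OF K assms(2)])
  finally show ?thesis by (simp add: gmnc_compact assms)
qed

text \<open>Unions reduce to the subadditivity for sums: for any \<open>b0\<close> in
  \<open>B\<close>, the set \<open>F \<union> B\<close> lies in \<open>K + B\<close>, where
  \<open>K\<close> is the compact set consisting of \<open>0\<close> and the translate of
  \<open>F\<close> by \<open>- b0\<close>. An empty \<open>B\<close> has no such point and is
  treated apart.\<close>

lemma gmnc_compact_Un:
  assumes F: "compact F" and B: "bounded B" and sub: "A \<subseteq> F \<union> B"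
  shows "\<nu> A \<le> \<nu> B"
proof (cases "B = {}")
  case True
  then have "\<nu> A \<le> \<nu> F" using sub F by (intro gmnc_mono compact_imp_bounded) auto
  then show ?thesis using gmnc_compact[OF F] gmnc_nonneg[OF B] by simp
next
  case False
  then obtain b0 where b0: "b0 \<in> B" by blast
  let ?K = "insert 0 ((\<lambda>x. x - b0) ` F)"
  have "x \<in> {k + b | k b. k \<in> ?K \<and> b \<in> B}" if "x \<in> F \<union> B" for x
  proof (cases "x \<in> B")
    case True
    then have "x = 0 + x \<and> 0 \<in> ?K \<and> x \<in> B" by simp
    then show ?thesis by blast
  next
    case False
    then have "x = (x - b0) + b0 \<and> x - b0 \<in> ?K \<and> b0 \<in> B" using that b0 by simp
    then show ?thesis by blast
  qed
  moreover have "compact ?K"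
    by (intro compact_insert compact_continuous_image F continuous_intros)
  ultimately show ?thesis using sub B by (intro gmnc_compact_plus) auto
qed

text \<open>The segments from \<open>0\<close> to points of \<open>B\<close> lie in the convex hull
  of \<open>insert 0 B\<close>; neither the closed hull nor the extra point increases the
  measure.\<close>

lemma gmnc_shrink:
  assumes "bounded B"
  shows "\<nu> {s *\<^sub>R b | s b. 0 \<le> s \<and> s \<le> 1 \<and> b \<in> B} \<le> \<nu> B"
proof -
  have bh: "bounded (closure (convex hull insert 0 B))"
    using assms by (simp add: bounded_closure bounded_convex_hull)
  have "s *\<^sub>R b \<in> convex hull insert 0 B" if "0 \<le> s" "s \<le> 1" "b \<in> B" for s b
  proof -
    have "(1 - s) *\<^sub>R 0 + s *\<^sub>R b \<in> convex hull insert 0 B"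
      using that by (intro convexD[OF convex_convex_hull] hull_inc) auto
    then show ?thesis by simp
  qed
  then have "{s *\<^sub>R b | s b. 0 \<le> s \<and> s \<le> 1 \<and> b \<in> B} \<subseteq> closure (convex hull insert 0 B)"
    using closure_subset by blast
  then have "\<nu> {s *\<^sub>R b | s b. 0 \<le> s \<and> s \<le> 1 \<and> b \<in> B} \<le> \<nu> (insert 0 B)"
    using gmnc_mono[OF bh] gmnc_hull[of "insert 0 B"] assms by fastforce
  also have "\<dots> \<le> \<nu> B" using assms by (intro gmnc_compact_Un[of "{0}"]) auto
  finally show ?thesis .
qed

end

section \<open>Monotone sequences and relative compactness\<close>

lemma convergent_subsequence:
  fixes x :: "nat \<Rightarrow> 'a::metric_space"
  assumes "compact (closure X)" "\<And>n. x n \<in> X"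
  obtains a r where "strict_mono r" "(\<lambda>n. x (r n)) \<longlonglongrightarrow> a"
proof -
  have "seq_compact (closure X)" using assms(1) by (simp add: compact_eq_seq_compact_metric)
  moreover have "\<forall>n. x n \<in> closure X" using assms(2) closure_subset by blast
  ultimately obtain a r where "strict_mono r" "(x \<circ> r) \<longlonglongrightarrow> a"
    by (rule seq_compactE)
  then show ?thesis using that by (simp add: o_def)
qed

context reproducing_normal_cone
begin

lemma limit_C: "(\<And>n::nat. f n \<in> C) \<Longrightarrow> f \<longlonglongrightarrow> a \<Longrightarrow> a \<in> C"
  using closed_sequentially[OF closed_C] by blast

text \<open>As the cone is closed, \<open>a\<close> is a lower bound of the whole sequence. Hence
  \<open>0 \<le> x m - a \<le> x (r N) - a\<close> for \<open>m \<ge> r N\<close>, and normality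
  controls every later term by one term of the subsequence.\<close>

lemma decreasing_limit:
  fixes x :: "nat \<Rightarrow> 'a"
  assumes dec: "\<And>n. x n - x (Suc n) \<in> C" and r: "strict_mono r" and lim: "(\<lambda>n. x (r n)) \<longlonglongrightarrow> a"
  shows "x \<longlonglongrightarrow> a"
proof -
  have mono: "x m - x (m + j) \<in> C" for m j
  proof (induction j)
    case (Suc j)
    then show ?case using diff_trans_C[OF dec[of "m + j"] Suc] by simp
  qed (simp add: zero_C)
  have above: "x m - a \<in> C" for m
  proof (rule limit_C)
    show "(\<lambda>n. x m - x (r (n + m))) \<longlonglongrightarrow> x m - a"
      using lim by (intro tendsto_intros) (rule LIMSEQ_ignore_initial_segment)
    fix n
    have "m \<le> r (n + m)" using seq_suble[OF r, of "n + m"] by simp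
    then show "x m - x (r (n + m)) \<in> C" using mono[of m "r (n + m) - m"] by simp
  qed
  obtain M where M: "M > 0" "\<And>x y. x \<in> C \<Longrightarrow> y - x \<in> C \<Longrightarrow> norm x \<le> M * norm y"
    by (rule normality) blast
  show ?thesis
  proof (rule LIMSEQ_I)
    fix e :: real assume "e > 0"
    then have "e / M > 0" using M(1) by simp
    then obtain N where N: "norm (x (r N) - a) < e / M"
      using LIMSEQ_D[OF lim] by blast
    have "norm (x m - a) < e" if "m \<ge> r N" for m
    proof -
      have "norm (x m - a) \<le> M * norm (x (r N) - a)"
        using mono[of "r N" "m - r N"] that by (intro M above) simp
      also have "\<dots> < e" using N M(1) by (simp add: field_simps)
      finally show ?thesis .
    qed
    then show "\<exists>no. \<forall>n\<ge>no. norm (x n - a) < e" by blast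
  qed
qed

lemma increasing_limit:
  fixes x :: "nat \<Rightarrow> 'a"
  assumes "\<And>n. x (Suc n) - x n \<in> C" "strict_mono r" "(\<lambda>n. x (r n)) \<longlonglongrightarrow> a"
  shows "x \<longlonglongrightarrow> a"
proof -
  have "(\<lambda>n. - x n) \<longlonglongrightarrow> - a"
    using assms by (intro decreasing_limit[of "\<lambda>n. - x n" r]) (auto intro: tendsto_minus)
  from tendsto_minus[OF this] show ?thesis by simp
qed

end

text \<open>One admissible real factor \<open>l < 1\<close> stands in for the infimum that defines
  \<open>map_gmnc\<close>.\<close>

locale condensing_cone_map = cone_map C h + gmnc \<nu>
  for C :: "'a::banach set" and h and \<nu> +
  fixes l :: real
  assumes l: "0 \<le> l" "l < 1"
    and condensing: "\<And>A. bounded A \<Longrightarrow> \<nu> (h ` A) \<le> l * \<nu> A"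
begin

lemma compact_closure_perturbed_image:
  assumes X: "bounded X" and F: "compact F" and K: "compact K"
    and sub: "X \<subseteq> F \<union> {k + s *\<^sub>R h x | k s x. k \<in> K \<and> 0 \<le> s \<and> s \<le> 1 \<and> x \<in> X}"
  shows "compact (closure X)"
proof -
  define S where "S = {s *\<^sub>R y | s y. 0 \<le> s \<and> s \<le> 1 \<and> y \<in> h ` X}"
  define D where "D = {k + b | k b. k \<in> K \<and> b \<in> S}"
  have hX: "bounded (h ` X)" by (rule bounded_image[OF X])
  have S: "bounded S" unfolding S_def by (rule bounded_shrink[OF hX])
  have D: "bounded D" unfolding D_def by (rule bounded_sumset[OF compact_imp_bounded[OF K] S])
  have "X \<subseteq> F \<union> D" using sub unfolding D_def S_def by blast
  then have "\<nu> X \<le> \<nu> D" by (rule gmnc_compact_Un[OF F D])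
  also have "\<dots> \<le> \<nu> S" by (rule gmnc_compact_plus[OF K S]) (simp add: D_def)
  also have "\<dots> \<le> \<nu> (h ` X)" unfolding S_def by (rule gmnc_shrink[OF hX])
  also have "\<dots> \<le> l * \<nu> X" by (rule condensing[OF X])
  finally have "(1 - l) * \<nu> X \<le> 0" by (simp add: algebra_simps)
  then have "\<nu> X = 0" using l gmnc_nonneg[OF X] by (simp add: mult_le_0_iff)
  then show ?thesis using gmnc_eq_0_iff[OF X] by simp
qed

lemma gmnc_funpow: "bounded A \<Longrightarrow> \<nu> ((h ^^ k) ` A) \<le> l ^ k * \<nu> A"
proof (induction k)
  case (Suc k)
  have "bounded ((h ^^ k) ` A)"
    by (rule cone_map.bounded_image[OF cone_map_funpow Suc.prems])
  then have "\<nu> (h ` (h ^^ k) ` A) \<le> l * \<nu> ((h ^^ k) ` A)" by (rule condensing)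
  also have "\<dots> \<le> l * (l ^ k * \<nu> A)" using Suc l by (intro mult_left_mono) auto
  finally show ?case by (simp add: image_comp mult_ac)
qed simp

end

subsection \<open>Condensing maps without fixed points in the cone\<close>

lemma compact_segment: "compact ((\<lambda>c. c *\<^sub>R u) ` {0..1::real})" for u :: "'a::real_normed_vector"
  by (intro compact_continuous_image continuous_intros) simp

text \<open>The assumption \<open>slow\<close> expresses an orbit radius of at most \<open>1\<close>
  through growth bounds. The missing fixed points concern the cone only, so that the reflected map
  can be treated as a second instance.\<close>

locale fixed_point_free_map = condensing_cone_map +
  assumes slow: "\<And>x \<rho>. \<rho> > 1 \<Longrightarrow> \<exists>M. \<forall>k. norm ((h ^^ k) x) \<le> M * \<rho> ^ k"
    and no_fixed_point: "\<And>x. x \<in> C \<Longrightarrow> h x = x \<Longrightarrow> x = 0"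
begin

text \<open>Iterating \<open>y \<le> t h(y)\<close> gives \<open>y \<le> t^k h^k(y)\<close>, and the
  right-hand side tends to \<open>0\<close> because orbits grow more slowly than
  \<open>(1/t)^k\<close>.\<close>

lemma no_supereigenvector:
  assumes y: "y \<in> C" "t *\<^sub>R h y - y \<in> C" and t: "0 < t" "t < 1"
  shows "y = 0"
proof -
  interpret s: cone_map C "\<lambda>x. t *\<^sub>R h x" by (rule cone_map_scaleR) (use t in simp)
  have "((\<lambda>x. t *\<^sub>R h x) ^^ k) y - y \<in> C" for k
  proof (induction k)
    case (Suc k)
    from diff_trans_C[OF y(2) s.map_mono[OF Suc]] show ?case by simp
  qed (simp add: zero_C)
  then have le: "t ^ k *\<^sub>R (h ^^ k) y - y \<in> C" for k
    using funpow_scaleR[of t k y] t by (metis less_imp_le)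
  obtain M where M: "M > 0" "\<And>x y. x \<in> C \<Longrightarrow> y - x \<in> C \<Longrightarrow> norm x \<le> M * norm y"
    by (rule normality) blast
  \<comment> \<open>The midpoint of \<open>1\<close> and \<open>1 / t\<close> exceeds
    \<open>1\<close>, as \<open>slow\<close> requires, and still satisfies
    \<open>t * \<rho> < 1\<close>.\<close>
  define \<rho> where "\<rho> = (1 + 1 / t) / 2"
  have \<rho>: "\<rho> > 1" "t * \<rho> = (t + 1) / 2" using t by (auto simp: \<rho>_def field_simps)
  obtain N where N: "\<And>k. norm ((h ^^ k) y) \<le> N * \<rho> ^ k" using slow[OF \<rho>(1)] by blast
  have "norm y \<le> M * N * ((t + 1) / 2) ^ k" for k
  proof -
    have "norm y \<le> M * (t ^ k * norm ((h ^^ k) y))"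
      using M(2)[OF y(1) le[of k]] t by simp
    also have "\<dots> \<le> M * (t ^ k * (N * \<rho> ^ k))"
      using N[of k] M(1) t by (intro mult_left_mono) auto
    also have "\<dots> = M * N * (t * \<rho>) ^ k" by (simp add: power_mult_distrib mult_ac)
    finally show ?thesis by (simp only: \<rho>(2))
  qed
  moreover have "(\<lambda>k. M * N * ((t + 1) / 2) ^ k) \<longlonglongrightarrow> M * N * 0"
    using t by (intro tendsto_mult tendsto_const LIMSEQ_realpow_zero) auto
  ultimately have "norm y \<le> 0" by (intro LIMSEQ_le_const) auto
  then show ?thesis by simp
qed

text \<open>The monotone iteration started at \<open>0\<close> converges to the solution if it is bounded. Otherwise
  dividing by the running maximum \<open>p\<close> of the norms gives a relatively compact sequence whose
  limit points of norm \<open>1\<close> satisfy \<open>a \<le> t h(a)\<close>. The maximum is monotone in the index, so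
  consecutive normalised terms differ by a factor at most \<open>1\<close>, even if the norm is not monotone.\<close>

lemma resolvent:
  assumes u: "u \<in> C" and t: "0 < t" "t < 1"
  obtains x where "x \<in> C" "x = u + t *\<^sub>R h x"
proof -
  define x where "x n = ((\<lambda>x. u + t *\<^sub>R h x) ^^ n) 0" for n
  have x0: "x 0 = 0" and xS: "x (Suc n) = u + t *\<^sub>R h (x n)" for n by (simp_all add: x_def)
  have x_C: "x n \<in> C" for n
    using t by (induction n) (auto simp: x0 xS zero_C intro!: add_C u scale_C map_C)
  have inc: "x (Suc n) - x n \<in> C" for n
  proof (induction n)
    case 0
    then show ?case using x_C[of 1] by (simp add: x0)
  next
    case (Suc n)
    then have "t *\<^sub>R (h (x (Suc n)) - h (x n)) \<in> C" using t by (intro scale_C map_mono) auto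
    then show ?case by (simp add: xS scaleR_right_diff_distrib)
  qed
  show ?thesis
  proof (cases "bounded (range x)")
    case True
    have "x n \<in> {0} \<union> {k + s *\<^sub>R h y | k s y. k \<in> {u} \<and> 0 \<le> s \<and> s \<le> 1 \<and> y \<in> range x}" for n
    proof (cases n)
      case (Suc m)
      have "x n = u + t *\<^sub>R h (x m) \<and> 0 \<le> t \<and> t \<le> 1" using t by (simp add: Suc xS)
      then show ?thesis by blast
    qed (simp add: x0)
    then have "compact (closure (range x))"
      by (intro compact_closure_perturbed_image[OF True, of "{0}" "{u}"]) auto
    then obtain a r where r: "strict_mono r" "(\<lambda>n. x (r n)) \<longlonglongrightarrow> a"
      by (rule convergent_subsequence) blast
    have a: "x \<longlonglongrightarrow> a" by (rule increasing_limit[OF inc r])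
    then have "(\<lambda>n. x (Suc n)) \<longlonglongrightarrow> u + t *\<^sub>R h a"
      unfolding xS by (intro tendsto_intros isCont_tendsto_compose[OF isCont_map])
    then have "a = u + t *\<^sub>R h a"
      by (rule LIMSEQ_unique[OF LIMSEQ_Suc[OF a]])
    with limit_C[OF x_C a] show ?thesis by (rule that)
  next
    case False
    define p where "p = rec_nat (1::real) (\<lambda>n q. max q (norm (x (Suc n))))"
    have p0: "p 0 = 1" and pS: "p (Suc n) = max (p n) (norm (x (Suc n)))" for n
      by (simp_all add: p_def)
    have p1: "p n \<ge> 1" for n by (induction n) (auto simp: p0 pS)
    have p_ge: "norm (x n) \<le> p n" for n by (cases n) (auto simp: x0 p0 pS)
    have large: "\<exists>n. norm (x n) = p n \<and> p n \<ge> real j + 1" for j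
    proof -
      \<comment> \<open>At the least index where the running maximum reaches the threshold it has
        just increased, so it equals the current norm. The threshold exceeds \<open>p 0 = 1\<close>,
        so this index is a successor.\<close>
      define P where "P n \<longleftrightarrow> p n \<ge> real j + 2" for n
      obtain n where "norm (x n) > real j + 2"
        using False unfolding bounded_iff by (metis not_le rangeE)
      then have "\<exists>n. P n" using p_ge unfolding P_def by (meson less_imp_le order_trans)
      then have least: "P (LEAST n. P n)" by (rule LeastI_ex)
      then obtain m where m: "(LEAST n. P n) = Suc m"
        by (cases "LEAST n. P n") (auto simp: P_def p0)
      then have "\<not> P m" using not_less_Least[of m P] by simp
      moreover have P_Suc: "P (Suc m)" using least m by simp
      ultimately have "p (Suc m) = norm (x (Suc m))" by (auto simp: P_def pS)
      then show ?thesis using P_Suc unfolding P_def by (intro exI[of _ "Suc m"]) auto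
    qed
    define y where "y n = (1 / p n) *\<^sub>R x n" for n
    have y_C: "y n \<in> C" for n using p1[of n] by (auto simp: y_def intro!: scale_C x_C)
    have hy: "h (y n) = (1 / p n) *\<^sub>R h (x n)" for n using p1[of n] by (simp add: y_def map_scale)
    have "norm (y n) \<le> 1" for n using p_ge[of n] p1[of n] by (simp add: y_def)
    then have bdd: "bounded (range y)" unfolding bounded_iff by blast
    have "y n \<in> {0} \<union> {k + s *\<^sub>R h z | k s z. k \<in> (\<lambda>c. c *\<^sub>R u) ` {0..1} \<and> 0 \<le> s \<and> s \<le> 1 \<and> z \<in> range y}"
      for n
    proof (cases n)
      case (Suc m)
      define s where "s = t * (p m / p n)"
      have pm: "p m \<le> p n" "p m > 0" "p n \<ge> 1" using p1[of m] p1[of n] by (auto simp: Suc pS)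
      have "y n = (1 / p n) *\<^sub>R u + s *\<^sub>R h (y m)"
        using pm unfolding Suc hy y_def[of "Suc m"] xS s_def by (simp add: scaleR_right_distrib)
      moreover have "s \<le> t * 1"
        unfolding s_def using pm t by (intro mult_left_mono) auto
      moreover have "0 \<le> s" unfolding s_def using pm t by simp
      moreover have "(1 / p n) *\<^sub>R u \<in> (\<lambda>c. c *\<^sub>R u) ` {0..1}" using pm by (intro imageI) auto
      ultimately have "y n = (1 / p n) *\<^sub>R u + s *\<^sub>R h (y m) \<and> (1 / p n) *\<^sub>R u \<in> (\<lambda>c. c *\<^sub>R u) ` {0..1} \<and>
        0 \<le> s \<and> s \<le> 1" using t by simp
      then show ?thesis by blast
    qed (simp add: y_def x0)
    from image_subsetI[of UNIV y, OF this] have cY: "compact (closure (range y))"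
      by (rule compact_closure_perturbed_image[OF bdd _ compact_segment, rotated]) simp
    obtain n where n: "\<And>j. norm (x (n j)) = p (n j)" "\<And>j. p (n j) \<ge> real j + 1"
      using large by metis
    obtain a r where r: "strict_mono r" "(\<lambda>j. y (n (r j))) \<longlonglongrightarrow> a"
      by (rule convergent_subsequence[OF cY, of "\<lambda>j. y (n j)"]) blast+
    have "norm (y (n j)) = 1" for j using n[of j] p1[of "n j"] by (simp add: y_def)
    then have "norm a = 1" using tendsto_norm[OF r(2)] by (simp add: LIMSEQ_const_iff)
    have "a \<in> C" using r(2) by (rule limit_C[rotated]) (rule y_C)
    have "(\<lambda>j. 1 / p (n (r j))) \<longlonglongrightarrow> 0"
    proof (rule Lim_null_comparison[OF always_eventually, OF allI])
      show "(\<lambda>j. 1 / (real j + 1)) \<longlonglongrightarrow> 0" by real_asymp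
      fix j
      have "real j + 1 \<le> p (n (r j))"
        using n(2)[of "r j"] seq_suble[OF r(1), of j] by linarith
      then show "norm (1 / p (n (r j))) \<le> 1 / (real j + 1)"
        by (simp add: frac_le)
    qed
    then have "(\<lambda>j. (1 / p (n (r j))) *\<^sub>R u + t *\<^sub>R h (y (n (r j))) - y (n (r j))) \<longlonglongrightarrow> 0 *\<^sub>R u + t *\<^sub>R h a - a"
      by (intro tendsto_intros isCont_tendsto_compose[OF isCont_map] r(2))
    \<comment> \<open>The recursion links \<open>y m\<close> to \<open>y (Suc m)\<close>, whose
      limit along the subsequence is not known. The inequality \<open>x m \<le> x (Suc m)\<close>
      divided by \<open>p m\<close> involves \<open>y m\<close> alone and survives the
      limit.\<close>
    moreover have "(1 / p m) *\<^sub>R u + t *\<^sub>R h (y m) - y m \<in> C" for m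
    proof -
      have "(1 / p m) *\<^sub>R (x (Suc m) - x m) \<in> C" using p1[of m] by (intro scale_C inc) auto
      then show ?thesis unfolding hy unfolding y_def by (simp add: xS algebra_simps)
    qed
    ultimately have "0 *\<^sub>R u + t *\<^sub>R h a - a \<in> C" by (rule limit_C[rotated])
    then have "a = 0" using no_supereigenvector[OF \<open>a \<in> C\<close> _ t] by simp
    with \<open>norm a = 1\<close> show ?thesis by simp
  qed
qed

text \<open>Solutions for factors \<open>t n\<close> tending to \<open>1\<close> either stay bounded
  and accumulate at a solution for \<open>1\<close>, or, divided by their norms along a subsequence,
  accumulate at a fixed point of norm \<open>1\<close> in the cone, which is excluded.\<close>

lemma resolvent_one:
  assumes u: "u \<in> C"
  obtains x where "x \<in> C" "x = u + h x"
proof -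
  define t where "t n = 1 - 1 / (real n + 2)" for n
  have t: "0 < t n" "t n < 1" for n by (auto simp: t_def field_simps)
  have t_lim: "t \<longlonglongrightarrow> 1" unfolding t_def by real_asymp
  have "\<exists>x. x \<in> C \<and> x = u + t n *\<^sub>R h x" for n by (rule resolvent[OF u t[of n]]) blast
  then obtain x where x_C: "\<And>n. x n \<in> C" and x: "\<And>n. x n = u + t n *\<^sub>R h (x n)" by metis
  show ?thesis
  proof (cases "bounded (range x)")
    case True
    have "x n \<in> {} \<union> {k + s *\<^sub>R h y | k s y. k \<in> {u} \<and> 0 \<le> s \<and> s \<le> 1 \<and> y \<in> range x}" for n
    proof -
      have "x n = u + t n *\<^sub>R h (x n) \<and> 0 \<le> t n \<and> t n \<le> 1" using x[of n] t[of n] by simp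
      then show ?thesis by blast
    qed
    then have "compact (closure (range x))"
      by (intro compact_closure_perturbed_image[OF True, of "{}" "{u}"]) auto
    then obtain a r where r: "strict_mono r" "(\<lambda>n. x (r n)) \<longlonglongrightarrow> a"
      by (rule convergent_subsequence) blast
    have "(\<lambda>n. t (r n)) \<longlonglongrightarrow> 1" using LIMSEQ_subseq_LIMSEQ[OF t_lim r(1)] by (simp add: o_def)
    then have "(\<lambda>n. u + t (r n) *\<^sub>R h (x (r n))) \<longlonglongrightarrow> u + 1 *\<^sub>R h a"
      by (intro tendsto_intros isCont_tendsto_compose[OF isCont_map] r(2))
    then have "(\<lambda>n. x (r n)) \<longlonglongrightarrow> u + h a" by (simp flip: x)
    then have "a = u + h a" by (rule LIMSEQ_unique[OF r(2)])
    with limit_C[OF x_C r(2)] show ?thesis by (rule that)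
  next
    case False
    \<comment> \<open>Indices with \<open>n \<ge> j\<close> are needed so that
      \<open>t (n j)\<close> still tends to \<open>1\<close>.\<close>
    have "\<exists>n\<ge>j. norm (x n) > real j + 1" for j
    proof (rule ccontr)
      assume "\<not> ?thesis"
      then have "range x \<subseteq> x ` {..<j} \<union> cball 0 (real j + 1)"
        by (auto simp: not_le not_less)
      moreover have "bounded (x ` {..<j} \<union> cball 0 (real j + 1))" by (simp add: finite_imp_bounded)
      ultimately show False using False bounded_subset by blast
    qed
    then obtain n where n: "\<And>j. n j \<ge> j" "\<And>j. norm (x (n j)) > real j + 1" by metis
    define c where "c j = 1 / norm (x (n j))" for j
    have c: "0 < c j" "c j \<le> 1 / (real j + 1)" for j
      using n(2)[of j] by (auto simp: c_def intro: frac_le)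
    define y where "y j = c j *\<^sub>R x (n j)" for j
    have y_C: "y j \<in> C" for j using c[of j] by (auto simp: y_def intro!: scale_C x_C)
    have y: "y j = c j *\<^sub>R u + t (n j) *\<^sub>R h (y j)" for j
    proof -
      have "y j = c j *\<^sub>R (u + t (n j) *\<^sub>R h (x (n j)))" unfolding y_def by (simp flip: x)
      moreover have "h (y j) = c j *\<^sub>R h (x (n j))" using c[of j] by (simp add: y_def map_scale)
      ultimately show ?thesis by (simp add: scaleR_right_distrib mult.commute)
    qed
    have norm_y: "norm (y j) = 1" for j
    proof -
      have "norm (x (n j)) \<noteq> 0" using n(2)[of j] by linarith
      then show ?thesis by (simp add: y_def c_def)
    qed
    then have bdd: "bounded (range y)" unfolding bounded_iff by auto
    have "y j \<in> {} \<union> {k + s *\<^sub>R h z | k s z. k \<in> (\<lambda>c. c *\<^sub>R u) ` {0..1} \<and> 0 \<le> s \<and> s \<le> 1 \<and> z \<in> range y}"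
      for j
    proof -
      have "1 / (real j + 1) \<le> 1" by simp
      then have "c j \<le> 1" using c(2)[of j] by linarith
      then have "c j *\<^sub>R u \<in> (\<lambda>c. c *\<^sub>R u) ` {0..1}" using c(1)[of j] by (intro imageI) auto
      then have "y j = c j *\<^sub>R u + t (n j) *\<^sub>R h (y j) \<and> c j *\<^sub>R u \<in> (\<lambda>c. c *\<^sub>R u) ` {0..1} \<and>
        0 \<le> t (n j) \<and> t (n j) \<le> 1" using y[of j] t[of "n j"] by simp
      then show ?thesis by blast
    qed
    from image_subsetI[of UNIV y, OF this] have "compact (closure (range y))"
      by (rule compact_closure_perturbed_image[OF bdd _ compact_segment, rotated]) simp
    then obtain a r where r: "strict_mono r" "(\<lambda>j. y (r j)) \<longlonglongrightarrow> a"
      by (rule convergent_subsequence) blast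
    have "norm a = 1" using tendsto_norm[OF r(2)] by (simp add: norm_y LIMSEQ_const_iff)
    have "a \<in> C" using r(2) by (rule limit_C[rotated]) (rule y_C)
    have "c \<longlonglongrightarrow> 0"
    proof (rule Lim_null_comparison[OF always_eventually, OF allI])
      show "(\<lambda>j. 1 / (real j + 1)) \<longlonglongrightarrow> 0" by real_asymp
      show "norm (c j) \<le> 1 / (real j + 1)" for j using c[of j] by simp
    qed
    then have cr: "(\<lambda>j. c (r j)) \<longlonglongrightarrow> 0" using LIMSEQ_subseq_LIMSEQ[OF _ r(1)] by (simp add: o_def)
    have "filterlim n at_top sequentially"
      using n(1) by (intro filterlim_at_top_mono[OF filterlim_ident always_eventually]) auto
    then have "(\<lambda>j. t (n j)) \<longlonglongrightarrow> 1" by (rule filterlim_compose[OF t_lim])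
    then have tr: "(\<lambda>j. t (n (r j))) \<longlonglongrightarrow> 1" using LIMSEQ_subseq_LIMSEQ[OF _ r(1)] by (simp add: o_def)
    have "(\<lambda>j. c (r j) *\<^sub>R u + t (n (r j)) *\<^sub>R h (y (r j))) \<longlonglongrightarrow> 0 *\<^sub>R u + 1 *\<^sub>R h a"
      by (intro tendsto_intros isCont_tendsto_compose[OF isCont_map] r(2) cr tr)
    then have "(\<lambda>j. y (r j)) \<longlonglongrightarrow> h a" by (simp flip: y)
    then have "h a = a" by (rule LIMSEQ_unique[OF _ r(2)])
    then have "a = 0" using no_fixed_point[OF \<open>a \<in> C\<close>] by simp
    with \<open>norm a = 1\<close> show ?thesis by simp
  qed
qed

text \<open>The solution of \<open>x = u + h x\<close> dominates \<open>u\<close> and satisfies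
  \<open>h x \<le> x\<close>. Its orbit decreases, is relatively compact, and can only converge to a
  fixed point in the cone, which is \<open>0\<close>; normality passes the convergence to
  \<open>u\<close>.\<close>

lemma orbits_tend_to_zero:
  assumes u: "u \<in> C"
  shows "(\<lambda>k. (h ^^ k) u) \<longlonglongrightarrow> 0"
proof -
  obtain x where x: "x \<in> C" "x = u + h x" by (rule resolvent_one[OF u])
  define d where "d k = (h ^^ k) x" for k
  have d_C: "d k \<in> C" for k unfolding d_def by (rule funpow_C[OF x(1)])
  have d0: "d 0 = x" and dS: "d (Suc k) = h (d k)" for k by (simp_all add: d_def)
  have "x - h x \<in> C" using u x(2) by (metis add_diff_cancel_right')
  then have dec: "d k - d (Suc k) \<in> C" for k
    unfolding d_def by (subst funpow_Suc_right) (simp add: funpow_mono)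
  obtain M where M: "M > 0" "\<And>x y. x \<in> C \<Longrightarrow> y - x \<in> C \<Longrightarrow> norm x \<le> M * norm y"
    by (rule normality) blast
  have "x - d k \<in> C" for k
  proof (induction k)
    case (Suc k)
    show ?case by (rule diff_trans_C[OF dec Suc])
  qed (simp add: d0 zero_C)
  then have "norm (d k) \<le> M * norm x" for k by (intro M d_C)
  then have bdd: "bounded (range d)" unfolding bounded_iff by blast
  have "d n \<in> {x} \<union> {k + s *\<^sub>R h y | k s y. k \<in> {0} \<and> 0 \<le> s \<and> s \<le> 1 \<and> y \<in> range d}" for n
  proof (cases n)
    case (Suc m)
    have "d n = 0 + 1 *\<^sub>R h (d m) \<and> 0 \<le> (1::real) \<and> 1 \<le> (1::real)" by (simp add: Suc dS)
    then show ?thesis by blast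
  qed (simp add: d0)
  then have "compact (closure (range d))"
    by (intro compact_closure_perturbed_image[OF bdd, of "{x}" "{0}"]) auto
  then obtain a r where r: "strict_mono r" "(\<lambda>n. d (r n)) \<longlonglongrightarrow> a"
    by (rule convergent_subsequence) blast
  have a: "d \<longlonglongrightarrow> a" by (rule decreasing_limit[OF dec r])
  then have "(\<lambda>n. d (Suc n)) \<longlonglongrightarrow> h a"
    unfolding dS by (intro isCont_tendsto_compose[OF isCont_map])
  then have "h a = a" by (rule LIMSEQ_unique[OF _ LIMSEQ_Suc[OF a]])
  then have "a = 0" using no_fixed_point[OF limit_C[OF d_C a]] by simp
  have "(\<lambda>k. M * norm (d k)) \<longlonglongrightarrow> M * norm a"
    by (intro tendsto_intros a)
  then have lim: "(\<lambda>k. M * norm (d k)) \<longlonglongrightarrow> 0" by (simp add: \<open>a = 0\<close>)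
  have "x - u \<in> C" using map_C[OF x(1)] x(2) by (metis add_diff_cancel_left')
  then have "norm ((h ^^ k) u) \<le> M * norm (d k)" for k
    using M(2)[OF funpow_C[OF u] funpow_mono] by (simp add: d_def)
  then show ?thesis
    by (rule Lim_null_comparison[OF always_eventually[OF allI] lim])
qed

text \<open>If the iterates did not decay uniformly on the unit ball of the cone, there would be
  \<open>w\<^sub>n = h\<^sup>n(u\<^sub>n)\<close> and \<open>j\<^sub>n \<ge> n\<close> with \<open>h\<^bsup>j\<^sub>n\<^esup>(w\<^sub>n)\<close> bounded away from zero. The condensing property makes
  the \<open>w\<^sub>n\<close> relatively compact, and as the cone is reproducing, a rapidly convergent subsequence
  has an upper bound \<open>v\<close>. But then the orbit of \<open>v\<close> does not tend to zero.\<close>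

lemma uniform_decay:
  assumes \<epsilon>: "\<epsilon> > 0"
  shows "\<forall>\<^sub>F k in sequentially. \<forall>u\<in>C. norm ((h ^^ k) u) \<le> \<epsilon> * norm u"
proof (rule ccontr)
  assume neg: "\<not> ?thesis"
  \<comment> \<open>The factor \<open>2\<close> leaves at least \<open>n\<close> further steps after
    the \<open>n\<close> steps spent on \<open>w n\<close>.\<close>
  have "\<exists>k u. 2 * n \<le> k \<and> u \<in> C \<and> norm u = 1 \<and> \<epsilon> < norm ((h ^^ k) u)" for n
  proof -
    obtain k u where k: "2 * n \<le> k" "u \<in> C" "\<epsilon> * norm u < norm ((h ^^ k) u)"
      using neg unfolding eventually_sequentially by (metis not_le)
    then have u: "norm u > 0" using \<epsilon> by (auto simp: funpow_zero)
    have "norm ((h ^^ k) ((1 / norm u) *\<^sub>R u)) = norm ((h ^^ k) u) / norm u"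
      by (simp add: funpow_scale)
    also have "\<dots> > \<epsilon>" using k(3) u by (simp add: field_simps)
    finally show ?thesis using k(1,2) u
      by (intro exI[of _ k] exI[of _ "(1 / norm u) *\<^sub>R u"]) (auto intro: scale_C)
  qed
  then obtain \<kappa> u where \<kappa>: "\<And>n. 2 * n \<le> \<kappa> n" and u: "\<And>n. u n \<in> C" "\<And>n. norm (u n) = 1"
    and big: "\<And>n. \<epsilon> < norm ((h ^^ \<kappa> n) (u n))" by metis
  have "\<exists>M. \<forall>k. norm ((h ^^ k) x) \<le> M" if "x \<in> C" for x
  proof -
    have "Bseq (\<lambda>k. (h ^^ k) x)"
      by (rule convergent_imp_Bseq[OF convergentI[OF orbits_tend_to_zero[OF that]]])
    then show ?thesis unfolding Bseq_def by blast
  qed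
  then obtain K where K: "K > 0" "\<And>u k. u \<in> C \<Longrightarrow> norm ((h ^^ k) u) \<le> K * norm u"
    by (rule uniformly_bounded_orbits_C) blast+
  define w where "w n = (h ^^ n) (u n)" for n
  have w_C: "w n \<in> C" for n unfolding w_def by (rule funpow_C[OF u(1)])
  have bdd: "bounded (range w)"
  proof -
    have "norm (w n) \<le> K" for n using K(2)[OF u(1), of n n] by (simp add: w_def u(2))
    then show ?thesis unfolding bounded_iff by blast
  qed
  \<comment> \<open>All but the first \<open>m\<close> terms lie in the image of one fixed ball
    under \<open>h ^^ m\<close>, and finitely many terms do not affect the bound.\<close>
  have "\<nu> (range w) \<le> l ^ m * \<nu> (cball 0 K)" for m
  proof -
    have im: "bounded ((h ^^ m) ` cball 0 K)"
      by (rule cone_map.bounded_image[OF cone_map_funpow]) simp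
    have "w n \<in> w ` {..<m} \<union> (h ^^ m) ` cball 0 K" for n
    proof (cases "n < m")
      case False
      then have "w n = (h ^^ m) ((h ^^ (n - m)) (u n))"
        using funpow_add[of m "n - m" h] by (simp add: w_def)
      moreover have "(h ^^ (n - m)) (u n) \<in> cball 0 K"
        using K(2)[OF u(1), of "n - m" n] by (simp add: u(2))
      ultimately show ?thesis by blast
    qed simp
    from image_subsetI[of UNIV w, OF this]
    have "\<nu> (range w) \<le> \<nu> ((h ^^ m) ` cball 0 K)"
      by (rule gmnc_compact_Un[OF _ im, rotated]) (simp add: finite_imp_compact)
    also have "\<dots> \<le> l ^ m * \<nu> (cball 0 K)" by (rule gmnc_funpow) simp
    finally show ?thesis .
  qed
  moreover have "(\<lambda>m. l ^ m * \<nu> (cball 0 K)) \<longlonglongrightarrow> 0 * \<nu> (cball 0 K)"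
    using l by (intro tendsto_mult tendsto_const LIMSEQ_realpow_zero) auto
  ultimately have "\<nu> (range w) \<le> 0" by (intro LIMSEQ_le_const) auto
  then have "\<nu> (range w) = 0" using gmnc_nonneg[OF bdd] by simp
  then have "compact (closure (range w))" using gmnc_eq_0_iff[OF bdd] by simp
  then obtain a r where r: "strict_mono r" "(\<lambda>n. w (r n)) \<longlonglongrightarrow> a"
    by (rule convergent_subsequence) blast
  \<comment> \<open>The geometric rate makes the positive parts \<open>Y i\<close> of
    \<open>w (n i) - a\<close> summable.\<close>
  have "\<exists>n\<ge>i. norm (w n - a) < (1/2) ^ i" for i :: nat
  proof -
    obtain N where "\<And>n. n \<ge> N \<Longrightarrow> norm (w (r n) - a) < (1/2) ^ i"
      using LIMSEQ_D[OF r(2), of "(1/2) ^ i"] by auto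
    then have "norm (w (r (max N i)) - a) < (1/2) ^ i" by simp
    moreover have "r (max N i) \<ge> i" using seq_suble[OF r(1), of "max N i"] by simp
    ultimately show ?thesis by blast
  qed
  then obtain n where n: "\<And>i. n i \<ge> i" "\<And>i. norm (w (n i) - a) < (1/2) ^ i" by metis
  obtain D where D: "D > 0"
    "\<And>v. \<exists>y\<in>C. \<exists>z\<in>C. norm y \<le> D * norm v \<and> norm z \<le> D * norm v \<and> v = y - z"
    by (rule decomposition) blast
  from D(2)[of "w (n i) - a" for i] obtain Y Z where YZ: "\<And>i. Y i \<in> C" "\<And>i. Z i \<in> C"
    "\<And>i. norm (Y i) \<le> D * norm (w (n i) - a)" "\<And>i. w (n i) - a = Y i - Z i" by metis
  have "norm (Y i) \<le> D * (1/2) ^ i" for i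
    using YZ(3)[of i] n(2)[of i] D(1) by (meson less_imp_le mult_left_mono order_trans)
  then have sum_Y: "summable Y"
    by (intro summable_comparison_test[of Y "\<lambda>i. D * (1/2) ^ i"])
      (auto intro!: summable_mult summable_geometric)
  \<comment> \<open>\<open>w (n i) = a + Y i - Z i \<le> a + Y i\<close>, and a single term
    \<open>Y i\<close> lies below the sum of the series.\<close>
  define v where "v = a + suminf Y"
  have v_C: "v \<in> C"
    unfolding v_def using limit_C[OF w_C r(2)] by (intro add_C suminf_C sum_Y YZ)
  have v_ge: "v - w (n i) \<in> C" for i
  proof -
    have "v - w (n i) = (suminf Y - Y i) + Z i"
      using YZ(4)[of i] by (simp add: v_def algebra_simps)
    then show ?thesis using add_C[OF term_le_suminf[OF sum_Y YZ(1)] YZ(2)] by simp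
  qed
  obtain M where M: "M > 0" "\<And>x y. x \<in> C \<Longrightarrow> y - x \<in> C \<Longrightarrow> norm x \<le> M * norm y"
    by (rule normality) blast
  have "\<epsilon> / M > 0" using \<epsilon> M(1) by simp
  then obtain N where N: "\<And>k. k \<ge> N \<Longrightarrow> norm ((h ^^ k) v) < \<epsilon> / M"
    using LIMSEQ_D[OF orbits_tend_to_zero[OF v_C]] by fastforce
  define j where "j = \<kappa> (n N) - n N"
  have "j \<ge> N" using \<kappa>[of "n N"] n(1)[of N] by (simp add: j_def)
  have "\<kappa> (n N) = j + n N" using \<kappa>[of "n N"] by (simp add: j_def)
  then have "(h ^^ \<kappa> (n N)) (u (n N)) = (h ^^ j) (w (n N))"
    by (simp add: funpow_add w_def)
  then have "\<epsilon> < norm ((h ^^ j) (w (n N)))" using big[of "n N"] by simp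
  also have "\<dots> \<le> M * norm ((h ^^ j) v)"
    by (rule M(2)[OF funpow_C[OF w_C] funpow_mono[OF v_ge]])
  also have "\<dots> < \<epsilon>" using N[OF \<open>j \<ge> N\<close>] M(1) by (simp add: field_simps)
  finally show False .
qed

end

lemma (in condensing_cone_map) condensing_reflect: "condensing_cone_map C (\<lambda>x. - h (- x)) \<nu> l"
proof -
  interpret g: cone_map C "\<lambda>x. - h (- x)" by (rule cone_map_reflect)
  show ?thesis
  proof
    fix A :: "'a set" assume A: "bounded A"
    let ?n = "\<lambda>x::'a. (-1) *\<^sub>R x"
    have nA: "bounded (?n ` A)" by (rule bounded_scaling[OF A])
    have "\<nu> ((\<lambda>x. - h (- x)) ` A) = \<nu> (?n ` h ` ?n ` A)" by (simp add: image_image)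
    also have "\<dots> = \<nu> (h ` ?n ` A)" using gmnc_scale[OF bounded_image[OF nA], of "-1"] by simp
    also have "\<dots> \<le> l * \<nu> (?n ` A)" by (rule condensing[OF nA])
    also have "\<dots> = l * \<nu> A" using gmnc_scale[OF A, of "-1"] by simp
    finally show "\<nu> ((\<lambda>x. - h (- x)) ` A) \<le> l * \<nu> A" .
  qed (rule l)+
qed

text \<open>Without a fixed point in the cone or its negative, both \<open>h\<close> and its
  reflection decay uniformly on the cone, and \<open>split_bound\<close> carries the decay to all
  vectors. \<open>no_decay\<close> is what remains of a spectral radius of at least
  \<open>1\<close>.\<close>

lemma (in condensing_cone_map) fixed_point_exists:
  assumes slow: "\<And>x \<rho>. \<rho> > 1 \<Longrightarrow> \<exists>M. \<forall>k. norm ((h ^^ k) x) \<le> M * \<rho> ^ k"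
    and no_decay: "\<not> (\<forall>\<^sub>F k in sequentially. \<forall>x. norm ((h ^^ k) x) \<le> 1/2 * norm x)"
  shows "\<exists>x \<in> (C \<union> uminus ` C) - {0}. h x = x"
proof (rule ccontr)
  assume neg: "\<not> ?thesis"
  interpret h: fixed_point_free_map C h \<nu> l
    using neg slow by unfold_locales auto
  interpret g: condensing_cone_map C "\<lambda>x. - h (- x)" \<nu> l by (rule condensing_reflect)
  interpret g: fixed_point_free_map C "\<lambda>x. - h (- x)" \<nu> l
  proof
    show "\<exists>M. \<forall>k. norm (((\<lambda>x. - h (- x)) ^^ k) x) \<le> M * \<rho> ^ k" if "\<rho> > 1" for x \<rho>
      using slow[OF that, of "- x"] by (simp add: funpow_reflect)
    show "x = 0" if "x \<in> C" "- h (- x) = x" for x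
    proof (rule ccontr)
      assume "x \<noteq> 0"
      moreover have "h (- x) = - x" using that(2) by (metis minus_minus)
      moreover have "- x \<in> uminus ` C" using that(1) by simp
      ultimately show False using neg by (metis DiffI UnI2 neg_equal_0_iff_equal singletonD)
    qed
  qed
  obtain N where N: "N > 0"
    "\<And>v. \<exists>y\<in>C. \<exists>z\<in>C. norm y \<le> N * norm v \<and> norm z \<le> N * norm v \<and>
       (\<forall>f. order_preserving C f \<longrightarrow> norm (f v) \<le> N * (norm (f y) + norm (f (- z))))"
    by (rule split_bound) blast
  \<comment> \<open>Chosen so that \<open>N * (2 * (\<epsilon> * N))\<close> equals
    \<open>1/2\<close>: one \<open>N\<close> comes from the sandwich and one from the
    decomposition.\<close>
  define \<epsilon> where "\<epsilon> = 1 / (4 * N * N)"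
  have \<epsilon>: "\<epsilon> > 0" using N(1) by (simp add: \<epsilon>_def)
  have "\<forall>\<^sub>F k in sequentially. \<forall>x. norm ((h ^^ k) x) \<le> 1/2 * norm x"
    using h.uniform_decay[OF \<epsilon>] g.uniform_decay[OF \<epsilon>]
  proof eventually_elim
    case (elim k)
    show ?case
    proof
      fix x
      obtain y z where yz: "y \<in> C" "z \<in> C" "norm y \<le> N * norm x" "norm z \<le> N * norm x"
        "norm ((h ^^ k) x) \<le> N * (norm ((h ^^ k) y) + norm ((h ^^ k) (- z)))"
        using N(2)[of x] funpow_order by blast
      have "norm ((h ^^ k) y) \<le> \<epsilon> * (N * norm x)"
        using bspec[OF elim(1) yz(1)] mult_left_mono[OF yz(3), of \<epsilon>] \<epsilon> by linarith
      moreover have "norm ((h ^^ k) (- z)) \<le> \<epsilon> * (N * norm x)"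
        using bspec[OF elim(2) yz(2)] mult_left_mono[OF yz(4), of \<epsilon>] \<epsilon>
        unfolding funpow_reflect norm_minus_cancel by linarith
      ultimately have "N * (norm ((h ^^ k) y) + norm ((h ^^ k) (- z))) \<le> N * (2 * (\<epsilon> * (N * norm x)))"
        using N(1) by (intro mult_left_mono) auto
      also have "\<dots> = 1/2 * norm x" using N(1) by (simp add: \<epsilon>_def)
      finally show "norm ((h ^^ k) x) \<le> 1/2 * norm x" using yz(5) by linarith
    qed
  qed
  with no_decay show False by blast
qed

subsection \<open>Spectral radii\<close>

lemma root_exponential_tendsto:
  fixes M q :: real
  assumes "M > 0" "q \<ge> 0"
  shows "(\<lambda>k. ennreal (root k (M * q ^ k))) \<longlonglongrightarrow> ennreal q"
proof (rule tendsto_ennrealI)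
  have "(\<lambda>k. root k M * q) \<longlonglongrightarrow> 1 * q"
    by (intro tendsto_intros LIMSEQ_root_const assms)
  moreover have "\<forall>\<^sub>F k in sequentially. root k M * q = root k (M * q ^ k)"
    using eventually_gt_at_top[of 0]
    by eventually_elim (simp add: real_root_mult real_root_power_cancel assms)
  ultimately show "(\<lambda>k. root k (M * q ^ k)) \<longlonglongrightarrow> q"
    by (simp add: tendsto_cong)
qed

lemma ennreal_real_between:
  assumes "a < (b :: ennreal)"
  obtains q where "q > 0" "a < ennreal q" "ennreal q < b"
proof -
  obtain c where c: "a < c" "c < b" using dense[OF assms] by blast
  then obtain q where q: "c = ennreal q" "q \<ge> 0"
    by (metis ennreal_cases not_less_iff_gr_or_eq top_greatest leD)
  then have "q \<noteq> 0" using c(1) by auto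
  with q c show ?thesis by (intro that[of q]) auto
qed

section \<open>Operator norm, orbit growth and comparison of the radii\<close>

context cone_map
begin

text \<open>\<open>onorm\<close> is a real supremum and bounds its quotients only if they are
  bounded above; \<open>norm_bound\<close> supplies this for the nonlinear \<open>h\<close>.\<close>

lemma quotient_le_onorm: "norm (h x) / norm x \<le> onorm h"
proof -
  obtain L where L: "L > 0" "\<And>x. norm (h x) \<le> L * norm x" by (rule norm_bound) blast
  have "norm (h y) / norm y \<le> L" for y
    using L by (cases "y = 0") (auto simp: divide_le_eq)
  then have "bdd_above (range (\<lambda>y. norm (h y) / norm y))" unfolding bdd_above_def by blast
  then show ?thesis unfolding onorm_def by (rule cSUP_upper[rotated]) simp
qed

lemma onorm_nonneg: "0 \<le> onorm h"
  using quotient_le_onorm[of 0] by simp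

lemma norm_le_onorm: "norm (h x) \<le> onorm h * norm x"
  using quotient_le_onorm[of x] by (cases "x = 0") (auto simp: map_zero divide_le_eq)

lemma orbit_radius_le:
  assumes q: "q > 0" and le: "\<And>x. \<exists>M. \<forall>k. norm ((h ^^ k) x) \<le> M * q ^ k"
  shows "orbit_radius h \<le> ennreal q"
  unfolding orbit_radius_def
proof (rule SUP_least)
  fix x
  obtain M where M: "\<And>k. norm ((h ^^ k) x) \<le> M * q ^ k" using le by blast
  have M': "norm ((h ^^ k) x) \<le> max M 1 * q ^ k" for k
    using order_trans[OF M mult_right_mono[of M "max M 1" "q ^ k"]] q by simp
  have "limsup (\<lambda>k. ennreal (root k (norm ((h ^^ k) x)))) \<le> limsup (\<lambda>k. ennreal (root k (max M 1 * q ^ k)))"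
  proof (rule Limsup_mono)
    show "\<forall>\<^sub>F k in sequentially. ennreal (root k (norm ((h ^^ k) x))) \<le> ennreal (root k (max M 1 * q ^ k))"
      using eventually_gt_at_top[of 0] by eventually_elim (intro ennreal_leI real_root_le_mono M')
  qed
  also have "\<dots> = ennreal q"
    using q by (intro lim_imp_Limsup root_exponential_tendsto) auto
  finally show "limsup (\<lambda>k. ennreal (root k (norm ((h ^^ k) x)))) \<le> ennreal q" .
qed

text \<open>A \<open>limsup\<close> below \<open>q\<close> gives the bound with constant
  \<open>1\<close> from some index on; the finitely many earlier quotients are absorbed into
  \<open>M\<close>.\<close>

lemma orbit_growth:
  assumes "orbit_radius h < ennreal q"
  shows "\<exists>M. \<forall>k. norm ((h ^^ k) x) \<le> M * q ^ k"
proof -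
  have q: "q > 0" using assms by (metis ennreal_neg not_less not_less_zero)
  have "limsup (\<lambda>k. ennreal (root k (norm ((h ^^ k) x)))) \<le> orbit_radius h"
    unfolding orbit_radius_def by (rule SUP_upper) simp
  then have "limsup (\<lambda>k. ennreal (root k (norm ((h ^^ k) x)))) < ennreal q"
    using assms by (rule le_less_trans)
  from Limsup_lessD[OF this] eventually_gt_at_top[of 0]
  have "\<forall>\<^sub>F k in sequentially. norm ((h ^^ k) x) \<le> q ^ k"
  proof eventually_elim
    case (elim k)
    then have "root k (norm ((h ^^ k) x)) \<le> q" by (simp add: ennreal_less_iff)
    then have "root k (norm ((h ^^ k) x)) ^ k \<le> q ^ k" using elim(2) by (intro power_mono) auto
    then show ?case using elim(2) by (simp add: real_root_pow_pos2)
  qed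
  then obtain N where N: "\<And>k. k \<ge> N \<Longrightarrow> norm ((h ^^ k) x) \<le> q ^ k"
    unfolding eventually_sequentially by blast
  define M where "M = 1 + (\<Sum>i<N. norm ((h ^^ i) x) / q ^ i)"
  have sum: "0 \<le> (\<Sum>i<N. norm ((h ^^ i) x) / q ^ i)" using q by (intro sum_nonneg) auto
  have "norm ((h ^^ k) x) \<le> M * q ^ k" for k
  proof (cases "k < N")
    case True
    then have "norm ((h ^^ k) x) / q ^ k \<le> (\<Sum>i<N. norm ((h ^^ i) x) / q ^ i)"
      using q by (intro member_le_sum) auto
    then have "norm ((h ^^ k) x) / q ^ k \<le> M" by (simp add: M_def)
    then show ?thesis using q by (simp add: divide_le_eq)
  next
    case False
    then have "norm ((h ^^ k) x) \<le> 1 * q ^ k" using N by simp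
    also have "\<dots> \<le> M * q ^ k" using sum q by (intro mult_right_mono) (auto simp: M_def)
    finally show ?thesis .
  qed
  then show ?thesis by blast
qed

lemma orbit_radius_le_iterate:
  assumes "m \<ge> 1" "q > 0" "\<And>x. norm ((h ^^ m) x) \<le> q ^ m * norm x"
  shows "orbit_radius h \<le> ennreal q"
proof -
  obtain M where M: "\<And>x k. norm ((h ^^ k) x) \<le> M * q ^ k * norm x"
    by (rule growth_rate_of_iterate[OF assms]) blast
  then have "\<forall>k. norm ((h ^^ k) x) \<le> (M * norm x) * q ^ k" for x by (simp add: mult_ac)
  then show ?thesis using assms(2) by (intro orbit_radius_le exI)
qed

lemma orbit_radius_finite:
  obtains R where "0 \<le> R" "orbit_radius h = ennreal R"
proof -
  obtain L where "L > 0" "\<And>x. norm (h x) \<le> L * norm x" by (rule norm_bound) blast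
  then have "orbit_radius h \<le> ennreal L" by (intro orbit_radius_le_iterate[of 1]) auto
  then show ?thesis using that by (metis ennreal_cases ennreal_less_top not_less)
qed

text \<open>Convergence and the value of the limit come together. Above the orbit radius, pointwise
  growth bounds become uniform and bound \<open>onorm (h ^^ k)\<close>. Below it, already one
  iterate of norm at most \<open>q ^ k\<close> would force the orbit radius down to
  \<open>q\<close>.\<close>

lemma bonsall_radius_eq_orbit_radius: "bonsall_radius h = orbit_radius h"
  unfolding bonsall_radius_def
proof (intro limI order_tendstoI)
  fix a assume "orbit_radius h < a"
  then obtain q where q: "q > 0" "orbit_radius h < ennreal q" "ennreal q < a"
    by (rule ennreal_real_between)
  obtain K where K: "K > 0" "\<And>x k. norm ((h ^^ k) x) \<le> K * q ^ k * norm x"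
    using uniform_growth_rate[OF q(1) orbit_growth[OF q(2)]] by blast
  have "onorm (h ^^ k) \<le> K * q ^ k" for k
    using K q(1) by (intro onorm_bound) auto
  then have le: "ennreal (root k (onorm (h ^^ k))) \<le> ennreal (root k (K * q ^ k))" if "k > 0" for k
    using that by (intro ennreal_leI real_root_le_mono)
  have "\<forall>\<^sub>F k in sequentially. ennreal (root k (K * q ^ k)) < a"
    using order_tendstoD(2)[OF root_exponential_tendsto q(3)] K(1) q(1) by simp
  then show "\<forall>\<^sub>F k in sequentially. ennreal (root k (onorm (h ^^ k))) < a"
    using eventually_gt_at_top[of 0] by eventually_elim (rule le_less_trans[OF le])
next
  fix a assume "a < orbit_radius h"
  then obtain q where q: "q > 0" "a < ennreal q" "ennreal q < orbit_radius h"
    by (rule ennreal_real_between)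
  have "a < ennreal (root k (onorm (h ^^ k)))" if k: "k > 0" for k
  proof (rule ccontr)
    interpret k: cone_map C "h ^^ k" by (rule cone_map_funpow)
    assume "\<not> ?thesis"
    then have "ennreal (root k (onorm (h ^^ k))) \<le> ennreal q" using q(2) by simp
    then have "root k (onorm (h ^^ k)) \<le> q" using q(1) by (simp add: ennreal_le_iff)
    then have "root k (onorm (h ^^ k)) ^ k \<le> q ^ k"
      using k k.onorm_nonneg by (intro power_mono) auto
    then have "onorm (h ^^ k) \<le> q ^ k" using k k.onorm_nonneg by (simp add: real_root_pow_pos2)
    then have "norm ((h ^^ k) x) \<le> q ^ k * norm x" for x
      using k.norm_le_onorm[of x] by (meson mult_right_mono norm_ge_zero order_trans)
    then have "orbit_radius h \<le> ennreal q" using k q(1) by (intro orbit_radius_le_iterate[of k]) auto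
    with q(3) show False by simp
  qed
  then show "\<forall>\<^sub>F k in sequentially. a < ennreal (root k (onorm (h ^^ k)))"
    using eventually_gt_at_top[of 0] by (rule eventually_mono[rotated])
qed

text \<open>The orbit of an eigenvector is \<open>l ^ k *\<^sub>R x\<close>, which outgrows every
  multiple of \<open>q ^ k\<close> with \<open>q < l\<close>.\<close>

lemma eigenvalue_le_orbit_radius:
  assumes l: "0 \<le> l" and x: "x \<noteq> 0" "h x = l *\<^sub>R x"
  shows "ennreal l \<le> orbit_radius h"
proof (rule ccontr)
  assume "\<not> ?thesis"
  then have "orbit_radius h < ennreal l" by simp
  then obtain q where q: "q > 0" "orbit_radius h < ennreal q" "ennreal q < ennreal l"
    by (rule ennreal_real_between)
  have ql: "q < l" using q by (simp add: ennreal_less_iff)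
  obtain M where M: "\<And>k. norm ((h ^^ k) x) \<le> M * q ^ k" using orbit_growth[OF q(2)] by blast
  have "(h ^^ k) x = l ^ k *\<^sub>R x" for k
    by (induction k) (auto simp: map_scale l x(2) mult.commute)
  then have "(l / q) ^ k * norm x \<le> M" for k
    using M[of k] l q(1) by (simp add: power_divide field_simps)
  moreover obtain k where "M / norm x < (l / q) ^ k"
    using real_arch_pow[of "l / q"] ql q(1) by auto
  ultimately show False using x(1) by (metis divide_less_eq not_le zero_less_norm_iff)
qed

section \<open>Eigenvectors by normalising the radius to one\<close>

lemma condensing_scaleR:
  assumes "homogeneous_gmnc \<nu>" "0 \<le> l" "l < R" "\<And>A. bounded A \<Longrightarrow> \<nu> (h ` A) \<le> l * \<nu> A"
  shows "condensing_cone_map C (\<lambda>x. (1 / R) *\<^sub>R h x) \<nu> (l / R)"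
proof -
  have R: "R > 0" using assms by simp
  interpret s: cone_map C "\<lambda>x. (1 / R) *\<^sub>R h x" by (rule cone_map_scaleR) (use R in simp)
  interpret gmnc \<nu> by unfold_locales (rule assms)
  show ?thesis
  proof
    fix A :: "'a set" assume A: "bounded A"
    have "\<nu> ((\<lambda>x. (1 / R) *\<^sub>R h x) ` A) = 1 / R * \<nu> (h ` A)"
      using gmnc_scale[OF bounded_image[OF A], of "1 / R"] R by (simp add: image_image)
    also have "\<dots> \<le> 1 / R * (l * \<nu> A)" using assms(4)[OF A] R by (intro mult_left_mono) auto
    finally show "\<nu> ((\<lambda>x. (1 / R) *\<^sub>R h x) ` A) \<le> l / R * \<nu> A" by simp
  qed (use assms R in auto)
qed

lemma eigenvector_exists:
  assumes \<nu>: "homogeneous_gmnc \<nu>" and less: "map_gmnc \<nu> h < orbit_radius h"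
    and R: "0 \<le> R" "orbit_radius h = ennreal R"
  shows "\<exists>x \<in> (C \<union> uminus ` C) - {0}. h x = R *\<^sub>R x"
proof -
  obtain l where l: "0 < l" "ennreal l < ennreal R" "\<And>A. bounded A \<Longrightarrow> \<nu> (h ` A) \<le> l * \<nu> A"
    using less unfolding R map_gmnc_def Inf_less_iff by auto
  then have "l < R" by (simp add: ennreal_less_iff)
  then have R0: "R > 0" using l(1) by simp
  interpret f: condensing_cone_map C "\<lambda>x. (1 / R) *\<^sub>R h x" \<nu> "l / R"
    by (rule condensing_scaleR) (use \<nu> l \<open>l < R\<close> in auto)
  have funpow: "norm (((\<lambda>x. (1 / R) *\<^sub>R h x) ^^ k) x) = norm ((h ^^ k) x) / R ^ k" for k x
    using funpow_scaleR[of "1 / R" k x] R0 by (simp add: power_divide)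
  have "\<exists>x \<in> (C \<union> uminus ` C) - {0}. (1 / R) *\<^sub>R h x = x"
  proof (rule f.fixed_point_exists)
    fix x \<rho> assume \<rho>: "1 < (\<rho> :: real)"
    have "orbit_radius h < ennreal (\<rho> * R)" using \<rho> R0 by (simp add: R(2) ennreal_less_iff)
    then obtain M where "\<And>k. norm ((h ^^ k) x) \<le> M * (\<rho> * R) ^ k" using orbit_growth by blast
    then show "\<exists>M. \<forall>k. norm (((\<lambda>x. (1 / R) *\<^sub>R h x) ^^ k) x) \<le> M * \<rho> ^ k"
      using R0 unfolding funpow by (intro exI[of _ M]) (simp add: divide_le_eq power_mult_distrib mult_ac)
  next
    show "\<not> (\<forall>\<^sub>F k in sequentially. \<forall>x. norm (((\<lambda>x. (1 / R) *\<^sub>R h x) ^^ k) x) \<le> 1/2 * norm x)"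
    proof
      assume "\<forall>\<^sub>F k in sequentially. \<forall>x. norm (((\<lambda>x. (1 / R) *\<^sub>R h x) ^^ k) x) \<le> 1/2 * norm x"
      then obtain N where N: "\<And>k x. k \<ge> N \<Longrightarrow> norm ((h ^^ k) x) / R ^ k \<le> 1/2 * norm x"
        unfolding funpow eventually_sequentially by blast
      define m where "m = Suc N"
      \<comment> \<open>This makes \<open>q ^ m\<close> half of \<open>R ^ m\<close>, so the decay
        of the \<open>m\<close>-th iterate yields an orbit radius of at most \<open>q < R\<close>.
        The index \<open>m = Suc N\<close> is positive, as roots require.\<close>
      define q where "q = root m (1/2) * R"
      have q: "0 < q" "q < R" "q ^ m = 1/2 * R ^ m"
        using R0 real_root_lt_1_iff[of m "1/2"]
        using real_root_pow_pos2[of m "1/2"] by (auto simp: q_def m_def power_mult_distrib simp del: power_Suc)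
      have "norm ((h ^^ m) x) \<le> q ^ m * norm x" for x
        using N[of m x] R0 unfolding q(3) by (simp add: m_def divide_le_eq mult_ac)
      then have "orbit_radius h \<le> ennreal q"
        using q(1) by (intro orbit_radius_le_iterate[of m]) (auto simp: m_def)
      then show False using q R by (simp add: ennreal_le_iff)
    qed
  qed
  then obtain x where x: "x \<in> (C \<union> uminus ` C) - {0}" "(1 / R) *\<^sub>R h x = x" by blast
  have "h x = R *\<^sub>R ((1 / R) *\<^sub>R h x)" using R0 by simp
  with x show ?thesis by auto
qed

end

theorem theorem6p2:
  fixes C :: "'a::banach set" and h :: "'a \<Rightarrow> 'a" and \<nu> :: "'a set \<Rightarrow> real"
  assumes "homogeneous_gmnc \<nu>"
    and "normal_cone C"
    and "reproducing_cone C"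
    and "continuous_on UNIV h"
    and "pos_homogeneous h"
    and "order_preserving C h"
  shows "bonsall_radius h = orbit_radius h \<and>
    (map_gmnc \<nu> h < orbit_radius h \<longrightarrow>
       orbit_radius h = eigenvalue_radius h \<and>
       (\<exists>x \<in> (C \<union> uminus ` C) - {0}. \<exists>l\<ge>0. orbit_radius h = ennreal l \<and> h x = l *\<^sub>R x)) \<and>
    (orbit_radius h \<le> 1 \<and> map_gmnc \<nu> h < 1 \<longrightarrow>
       ((\<exists>!x. h x = x) \<longleftrightarrow> orbit_radius h < 1) \<and>
       ((\<forall>x. h x = x \<longrightarrow> x = 0) \<longleftrightarrow> orbit_radius h < 1))"
proof -
  interpret cone_map C h using assms by unfold_locales auto
  obtain R where R: "0 \<le> R" "orbit_radius h = ennreal R" by (rule orbit_radius_finite)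
  have eigen: "\<exists>x \<in> (C \<union> uminus ` C) - {0}. h x = R *\<^sub>R x" if "map_gmnc \<nu> h < orbit_radius h"
    by (rule eigenvector_exists[OF assms(1) that R])
  have eq: "orbit_radius h = eigenvalue_radius h" if "map_gmnc \<nu> h < orbit_radius h"
  proof (rule antisym)
    show "orbit_radius h \<le> eigenvalue_radius h"
      unfolding eigenvalue_radius_def using eigen[OF that] R by (intro Sup_upper) auto
    show "eigenvalue_radius h \<le> orbit_radius h"
      unfolding eigenvalue_radius_def
      by (rule Sup_least) (auto intro: eigenvalue_le_orbit_radius)
  qed
  have zero: "(\<forall>x. h x = x \<longrightarrow> x = 0) \<longleftrightarrow> orbit_radius h < 1"
    if "orbit_radius h \<le> 1" "map_gmnc \<nu> h < 1"
  proof
    assume *: "\<forall>x. h x = x \<longrightarrow> x = 0"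
    show "orbit_radius h < 1"
    proof (rule ccontr)
      assume "\<not> orbit_radius h < 1"
      then have "orbit_radius h = 1" using that(1) by simp
      \<comment> \<open>For \<open>R = 1\<close> the eigenvector is a nonzero fixed point.\<close>
      then have "R = 1" "map_gmnc \<nu> h < orbit_radius h" using R that(2) by auto
      with eigen * show False by auto
    qed
  next
    assume less: "orbit_radius h < 1"
    show "\<forall>x. h x = x \<longrightarrow> x = 0"
    proof (intro allI impI, rule ccontr)
      fix x assume "h x = x" "x \<noteq> 0"
      then have "ennreal 1 \<le> orbit_radius h" by (intro eigenvalue_le_orbit_radius) auto
      with less show False by simp
    qed
  qed
  \<comment> \<open>Since \<open>0\<close> is always fixed, a unique fixed point must be
    \<open>0\<close>.\<close>
  have "(\<exists>!x. h x = x) \<longleftrightarrow> (\<forall>x. h x = x \<longrightarrow> x = 0)"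
    using map_zero by metis
  then show ?thesis
    using bonsall_radius_eq_orbit_radius eigen eq zero R by blast
qed

end
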